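(* Let $J$ be the monic Jacobi matrix associated with a nonrational function $F\in\mathbf N_{-\infty}$, let $s_{-1}\in\mathbb R$, and let $J=\mathfrak U\mathfrak L$ be the block $UL$-factorization of $J$ corresponding to the parameter $s_{-1}$. Then $\mathfrak J=\mathfrak L\mathfrak U$ is the monic generalized Jacobi matrix associated with the function $\frac{F(\lambda)}{\lambda}-\frac{s_{-1}}{\lambda}\in\mathbf D^+_{-\infty}$.
   Context: $\lambda\widehat\to\infty$ means that $\lambda\to\infty$ inside a sector $\varepsilon<\arg\lambda<\pi-\varepsilon$, $\varepsilon>0$. $\mathbf N$ is the class of Nevanlinna functions (analytic in $\mathbb C_+$, mapping $\mathbb C_+$ into $\mathbb C_+$). $\mathbf N_{-\infty}$ is the set of $F\in\mathbf N$ for which there are real $s_0,s_1,\dots$ with $F(\lambda)=-\frac{s_0}{\lambda}-\dots-\frac{s_{2n}}{\lambda^{2n+1}}+o(\lambda^{-2n-1})$, $\lambda\widehat\to\infty$, for every $n\in\mathbb Z_+$ (written $F(\lambda)\sim-\sum_j s_j\lambda^{-j-1}$); equivalently $F(\lambda)=\int_{\mathbb R}\frac{d\sigma(t)}{t-\lambda}$ with a finite measure $\sigma$ with moments $s_j=\int t^jd\sigma(t)$. The polynomials of the first kind $P_j$ are the monic orthogonal polynomials of $\sigma/s_0$: $\lambda P_j=P_{j+1}+b_jP_j+c_{j-1}P_{j-1}$, $P_{-1}=0$, $P_0=1$, $b_j\in\mathbb R$, $c_j>0$; those of the second kind are $Q_j(\lambda)=\int\frac{P_j(\lambda)-P_j(t)}{\lambda-t}d\sigma(t)$.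 The monic Jacobi matrix $J$ associated with $F$ is the semi-infinite tridiagonal matrix with $J_{j,j}=b_j$, $J_{j,j+1}=1$, $J_{j+1,j}=c_j$. $\mathbf D^+_{-\infty}$: functions $\mathfrak F$ meromorphic in $\mathbb C_+$ with $\mathfrak F(\lambda)\sim-\sum_{j\ge0}\mathfrak s_j\lambda^{-j-1}$, $\mathfrak s_j\in\mathbb R$, and $\lambda\mathfrak F(\lambda)+\mathfrak s_0\in\mathbf N_{-\infty}$. $\mathbf D^-_{-\infty}$: functions $\mathfrak F$ meromorphic in $\mathbb C_+$ such that for some $\mathfrak s_{-1}\in\mathbb R\setminus\{0\}$ one has $-\frac{\mathfrak s_{-1}}{\lambda}+\frac{\mathfrak F(\lambda)}{\lambda}\in\mathbf N_{-\infty}$. Normal indices of a real sequence $\{\mathfrak s_j\}_{j\ge0}$: the integers $n\ge1$ with $\det(\mathfrak s_{i+k})_{i,k=0}^{n-1}\neq0$, listed increasingly $\mathfrak n_1<\mathfrak n_2<\cdots$; $\mathfrak n_0=0$, $\mathfrak k_j=\mathfrak n_{j+1}-\mathfrak n_j$ (always $\mathfrak k_j\in\{1,2\}$ here). Generalized Jacobi matrix: let $\mathfrak F\in\mathbf D^\pm_{-\infty}$ be nonrational with $\mathfrak F\sim-\sum\mathfrak s_j\lambda^{-j-1}$. It is normalized if its first nonzero coefficient $\mathfrak s_{\mathfrak n_1-1}$ has modulus $1$. For normalized $\mathfrak F$ put $\mathfrak F_0=\mathfrak F$ and define recursively $-1/\mathfrak F_j(\lambda)=\epsilon_j\mathfrak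 p_j(\lambda)+\mathfrak b_j^2\mathfrak F_{j+1}(\lambda)$, where $\epsilon_j=\pm1$ is the first nonzero asymptotic coefficient of $\mathfrak F_j$, $\mathfrak p_j$ is the monic polynomial (of degree $\mathfrak k_j$) for which $-1/\mathfrak F_j-\epsilon_j\mathfrak p_j=o(1)$ as $\lambda\widehat\to\infty$, and $\mathfrak b_j>0$ is such that $\mathfrak F_{j+1}$ is normalized. Put $\mathfrak c_j=\epsilon_j\epsilon_{j+1}\mathfrak b_j^2$; write $\mathfrak p_j(\lambda)=\lambda+\mathfrak p_0^{(j)}$ if $\mathfrak k_j=1$ and $\mathfrak p_j(\lambda)=\lambda^2+\mathfrak p_1^{(j)}\lambda+\mathfrak p_0^{(j)}$ if $\mathfrak k_j=2$. The monic generalized Jacobi matrix associated with $\mathfrak F$ is the block tridiagonal matrix with diagonal blocks $\mathfrak B_j=-\mathfrak p_0^{(j)}$ if $\mathfrak k_j=1$, $\mathfrak B_j=\begin{pmatrix}0&1\\-\mathfrak p_0^{(j)}&-\mathfrak p_1^{(j)}\end{pmatrix}$ if $\mathfrak k_j=2$, superdiagonal blocks $\mathfrak D_j$ ($\mathfrak k_j\times\mathfrak k_{j+1}$, lower-left entry $1$, other entries $0$) and subdiagonal blocks $\mathfrak C_j$ ($\mathfrak k_{j+1}\times\mathfrak k_j$, lower-left entry $\mathfrak c_j$, other entries $0$). If $\mathfrak F$ is not normalized, the matrix associated with $\mathfrak F$ is by definition the one associated with $\mathfrak F/|\mathfrak s_{\mathfrak n_1-1}|$. Block $UL$-factorization of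 $J$ with parameter $s_{-1}$: put $\widehat P_j=Q_j+s_{-1}P_j$; let $\{\mathfrak n_j\}_{j\ge1}$ be the normal indices of $(s_{-1},s_0,s_1,\dots)$, $\mathfrak n_0=0$, and $\mathfrak k_j=\mathfrak n_{j+1}-\mathfrak n_j$, $j\in\mathbb Z_+$; one has $\widehat P_{\mathfrak n_j-1}(0)\neq0$, $j\in\mathbb N$. It is the factorization $J=\mathfrak U\mathfrak L$ in which $\mathfrak L$ is block lower bidiagonal with diagonal blocks $\mathfrak E_j$ and subdiagonal blocks $\mathfrak L_j$ ($\mathfrak k_j\times\mathfrak k_{j-1}$, in block row $j$, $j\ge1$, with lower-right entry $\mathfrak l_j$ and other entries $0$), $\mathfrak U$ is block upper bidiagonal with diagonal blocks $\mathfrak U_j$ and superdiagonal blocks $\mathfrak D_j$ ($\mathfrak k_j\times\mathfrak k_{j+1}$, lower-left entry $1$, other entries $0$), where $\mathfrak U_j=\mathfrak u_j$, $\mathfrak E_j=1$ if $\mathfrak k_j=1$ and $\mathfrak U_j=\begin{pmatrix}0&1\\ \mathfrak u_j&0\end{pmatrix}$, $\mathfrak E_j=\begin{pmatrix}1&0\\ \mathfrak e_j&1\end{pmatrix}$ if $\mathfrak k_j=2$, and $\mathfrak l_j=-\widehat P_{\mathfrak n_{j+1}-1}(0)/\widehat P_{\mathfrak n_j-1}(0)$, $j\in\mathbb N$. *)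

theory Defs
  imports
    "Jordan_Normal_Form.Determinant"
    "HOL-Library.Infinite_Set"
    "HOL-Library.Landau_Symbols"
    "HOL-Computational_Algebra.Polynomial"
    "HOL-Analysis.Analysis"
    "HOL-Complex_Analysis.Complex_Analysis"
begin

section \<open>Function classes\<close>

text \<open>Functions on the upper half plane are total functions on \<open>complex\<close>; only their values
  on \<open>upper_half_plane\<close> matter.\<close>

definition upper_half_plane :: "complex set" where
  "upper_half_plane = {z. Im z > 0}"

text \<open>Nontangential convergence to infinity is a property required for every \<open>\<epsilon> > 0\<close> along
  the following filter. For \<open>\<epsilon> \<ge> pi / 2\<close> the sector is empty and the filter is trivial.\<close>

definition sector_infinity :: "real \<Rightarrow> complex filter" where
  "sector_infinity \<epsilon> = inf at_infinity (principal {z. \<epsilon> < Arg z \<and> Arg z < pi - \<epsilon>})"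

text \<open>\<open>F \<sim> - (\<Sum>j. s j / z ^ (j + 1))\<close>\<close>

definition has_asymptotics :: "(complex \<Rightarrow> complex) \<Rightarrow> (nat \<Rightarrow> real) \<Rightarrow> bool" where
  "has_asymptotics F s \<longleftrightarrow>
     (\<forall>n. \<forall>\<epsilon>>0. (\<lambda>z. F z - (- (\<Sum>j\<le>2 * n. of_real (s j) / z ^ (j + 1))))
        \<in> o[sector_infinity \<epsilon>](\<lambda>z. 1 / z ^ (2 * n + 1)))"

definition nevanlinna :: "(complex \<Rightarrow> complex) set" where
  "nevanlinna = {F. F holomorphic_on upper_half_plane \<and> F ` upper_half_plane \<subseteq> upper_half_plane}"

definition N_minus_inf :: "(complex \<Rightarrow> complex) set" where
  "N_minus_inf = {F \<in> nevanlinna. \<exists>s. has_asymptotics F s}"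

definition D_plus_minus_inf :: "(complex \<Rightarrow> complex) set" where
  "D_plus_minus_inf = {F. F meromorphic_on upper_half_plane \<and>
     (\<exists>s. has_asymptotics F s \<and> (\<lambda>z. z * F z + of_real (s 0)) \<in> N_minus_inf)}"

definition D_minus_minus_inf :: "(complex \<Rightarrow> complex) set" where
  "D_minus_minus_inf = {F. F meromorphic_on upper_half_plane \<and>
     (\<exists>sm :: real. sm \<noteq> 0 \<and> (\<lambda>z. - of_real sm / z + F z / z) \<in> N_minus_inf)}"

definition rational_function :: "(complex \<Rightarrow> complex) \<Rightarrow> bool" where
  "rational_function F \<longleftrightarrow> (\<exists>p q :: complex poly. q \<noteq> 0 \<and>
     (\<forall>z\<in>upper_half_plane. poly q z \<noteq> 0 \<longrightarrow> F z = poly p z / poly q z))"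

section \<open>Orthogonal polynomials and the monic Jacobi matrix\<close>

definition representing_measure :: "real measure \<Rightarrow> (complex \<Rightarrow> complex) \<Rightarrow> bool" where
  "representing_measure \<sigma> F \<longleftrightarrow> finite_measure \<sigma> \<and> sets \<sigma> = sets borel \<and>
     (\<forall>j. integrable \<sigma> (\<lambda>t. t ^ j)) \<and>
     (\<forall>z\<in>upper_half_plane. F z = (LINT t|\<sigma>. 1 / (of_real t - z)))"

definition moment :: "real measure \<Rightarrow> nat \<Rightarrow> real" where
  "moment \<sigma> j = (LINT t|\<sigma>. t ^ j)"

text \<open>Orthogonality with respect to \<open>\<sigma>\<close> is the same as with respect to the normalized measure
  \<open>\<sigma> / s\<^sub>0\<close>.\<close>

definition monic_orthogonal :: "real measure \<Rightarrow> (nat \<Rightarrow> real poly) \<Rightarrow> bool" where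
  "monic_orthogonal \<sigma> P \<longleftrightarrow>
     (\<forall>j. degree (P j) = j \<and> lead_coeff (P j) = 1) \<and>
     (\<forall>i j. i \<noteq> j \<longrightarrow> (LINT t|\<sigma>. poly (P i) t * poly (P j) t) = 0)"

text \<open>The integrand is the polynomial \<open>(p x - p t) / (x - t)\<close> in \<open>t\<close>. The division is carried
  out in the polynomial ring, so that the value at \<open>t = x\<close> (which may be an atom of \<open>\<sigma>\<close>) is
  \<open>p' x\<close>, and not the value of a fraction with denominator \<open>0\<close>.\<close>

definition second_kind :: "real measure \<Rightarrow> real poly \<Rightarrow> real \<Rightarrow> real" where
  "second_kind \<sigma> p x = (LINT t|\<sigma>. poly (([:poly p x:] - p) div [:x, -1:]) t)"

definition three_term_recurrence ::
    "(nat \<Rightarrow> real poly) \<Rightarrow> (nat \<Rightarrow> real) \<Rightarrow> (nat \<Rightarrow> real) \<Rightarrow> bool" where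
  "three_term_recurrence P b c \<longleftrightarrow>
     (\<forall>j. [:0, 1:] * P j =
        P (j + 1) + smult (b j) (P j) + (if j = 0 then 0 else smult (c (j - 1)) (P (j - 1))))"

type_synonym inf_matrix = "nat \<Rightarrow> nat \<Rightarrow> real"

definition jacobi_matrix :: "(nat \<Rightarrow> real) \<Rightarrow> (nat \<Rightarrow> real) \<Rightarrow> inf_matrix" where
  "jacobi_matrix b c i j =
     (if i = j then b i else if j = i + 1 then 1 else if i = j + 1 then c j else 0)"

definition monic_jacobi_matrix_of ::
    "real measure \<Rightarrow> (nat \<Rightarrow> real poly) \<Rightarrow> inf_matrix \<Rightarrow> bool" where
  "monic_jacobi_matrix_of \<sigma> P J \<longleftrightarrow> monic_orthogonal \<sigma> P \<and>
     (\<exists>b c. three_term_recurrence P b c \<and> (\<forall>j. c j > 0) \<and> J = jacobi_matrix b c)"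

section \<open>Normal indices and block matrices\<close>

definition hankel_det :: "(nat \<Rightarrow> real) \<Rightarrow> nat \<Rightarrow> real" where
  "hankel_det s n = Determinant.det (Matrix.mat n n (\<lambda>(i, k). s (i + k)))"

text \<open>\<open>normal_index s 0 = 0\<close>, followed by the normal indices in increasing order. This is
  meant for sequences with infinitely many normal indices.\<close>

definition normal_index :: "(nat \<Rightarrow> real) \<Rightarrow> nat \<Rightarrow> nat" where
  "normal_index s = enumerate (insert 0 {n. 1 \<le> n \<and> hankel_det s n \<noteq> 0})"

definition block_size :: "(nat \<Rightarrow> nat) \<Rightarrow> nat \<Rightarrow> nat" where
  "block_size n j = n (j + 1) - n j"

text \<open>Block matrix whose block \<open>(i, j)\<close> occupies the rows \<open>n i, \<dots>, n (i + 1) - 1\<close> and the columns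
  \<open>n j, \<dots>, n (j + 1) - 1\<close>, for a strictly increasing sequence \<open>n\<close> with \<open>n 0 = 0\<close>; the blocks
  \<open>B i j\<close> are given with local indices starting at \<open>0\<close>.\<close>

definition block_of :: "(nat \<Rightarrow> nat) \<Rightarrow> nat \<Rightarrow> nat" where
  "block_of n r = (LEAST j. r < n (j + 1))"

definition block_matrix :: "(nat \<Rightarrow> nat) \<Rightarrow> (nat \<Rightarrow> nat \<Rightarrow> inf_matrix) \<Rightarrow> inf_matrix" where
  "block_matrix n B r c =
     (let i = block_of n r; j = block_of n c in B i j (r - n i) (c - n j))"

definition explicit_block :: "real list list \<Rightarrow> inf_matrix" where
  "explicit_block M a b = M ! a ! b"

text \<open>A block with \<open>k\<close> rows and lower-left entry \<open>x\<close>; a \<open>k \<times> k'\<close> block with lower-right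
  entry \<open>x\<close>.\<close>

definition lower_left_block :: "nat \<Rightarrow> real \<Rightarrow> inf_matrix" where
  "lower_left_block k x a b = (if a = k - 1 \<and> b = 0 then x else 0)"

definition lower_right_block :: "nat \<Rightarrow> nat \<Rightarrow> real \<Rightarrow> inf_matrix" where
  "lower_right_block k k' x a b = (if a = k - 1 \<and> b = k' - 1 then x else 0)"

text \<open>All products below have finitely many nonzero terms, the left factors being banded.\<close>

definition inf_matrix_mult :: "inf_matrix \<Rightarrow> inf_matrix \<Rightarrow> inf_matrix"  (infixl \<open>\<star>\<close> 70) where
  "(A \<star> B) i j = (\<Sum>k. A i k * B k j)"

section \<open>Block UL factorization\<close>

definition P_hat :: "real measure \<Rightarrow> (nat \<Rightarrow> real poly) \<Rightarrow> real \<Rightarrow> nat \<Rightarrow> real \<Rightarrow> real" where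
  "P_hat \<sigma> P sm j x = second_kind \<sigma> (P j) x + sm * poly (P j) x"

text \<open>The diagonal blocks are distinguished by size \<open>1\<close> or not; in the cases of interest the
  other possible size is \<open>2\<close>.\<close>

definition upper_factor :: "(nat \<Rightarrow> nat) \<Rightarrow> (nat \<Rightarrow> real) \<Rightarrow> inf_matrix" where
  "upper_factor n u = block_matrix n (\<lambda>i j.
     if i = j then
       (if block_size n i = 1 then explicit_block [[u i]] else explicit_block [[0, 1], [u i, 0]])
     else if j = i + 1 then lower_left_block (block_size n i) 1
     else (\<lambda>_ _. 0))"

definition lower_factor :: "(nat \<Rightarrow> nat) \<Rightarrow> (nat \<Rightarrow> real) \<Rightarrow> (nat \<Rightarrow> real) \<Rightarrow> inf_matrix" where
  "lower_factor n e l = block_matrix n (\<lambda>i j.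
     if i = j then
       (if block_size n i = 1 then explicit_block [[1]] else explicit_block [[1, 0], [e i, 1]])
     else if i = j + 1 then lower_right_block (block_size n i) (block_size n j) (l i)
     else (\<lambda>_ _. 0))"

text \<open>The normal indices are those of the sequence \<open>s\<^sub>-\<^sub>1, s\<^sub>0, s\<^sub>1, \<dots>\<close> with
  \<open>s\<^sub>-\<^sub>1 = sm\<close>.\<close>

definition block_UL_factorization ::
    "real measure \<Rightarrow> (nat \<Rightarrow> real poly) \<Rightarrow> real \<Rightarrow> inf_matrix \<Rightarrow> inf_matrix \<Rightarrow> inf_matrix \<Rightarrow> bool" where
  "block_UL_factorization \<sigma> P sm J U L \<longleftrightarrow>
     (let n = normal_index (case_nat sm (moment \<sigma>));
          l = (\<lambda>j. - P_hat \<sigma> P sm (n (j + 1) - 1) 0 / P_hat \<sigma> P sm (n j - 1) 0)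
      in \<exists>u e. U = upper_factor n u \<and> L = lower_factor n e l \<and> J = U \<star> L)"

section \<open>Monic generalized Jacobi matrices\<close>

definition first_nonzero :: "(nat \<Rightarrow> real) \<Rightarrow> real" where
  "first_nonzero s = s (LEAST i. s i \<noteq> 0)"

definition first_asymptotic_coeff :: "(complex \<Rightarrow> complex) \<Rightarrow> real \<Rightarrow> bool" where
  "first_asymptotic_coeff F x \<longleftrightarrow>
     (\<exists>s. has_asymptotics F s \<and> (\<exists>i. s i \<noteq> 0) \<and> first_nonzero s = x)"

text \<open>The recursion \<open>- 1 / \<Phi>\<^sub>j = \<epsilon>\<^sub>j p\<^sub>j + \<beta>\<^sub>j\<^sup>2 \<Phi>\<^sub>j\<^sub>+\<^sub>1\<close> between normalized meromorphic functions. It is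
  not imposed at zeros of \<open>\<Phi>\<^sub>j\<close>, where \<open>\<Phi>\<^sub>j\<^sub>+\<^sub>1\<close> has a pole.\<close>

definition continued_fraction_expansion ::
    "(nat \<Rightarrow> complex \<Rightarrow> complex) \<Rightarrow> (nat \<Rightarrow> real) \<Rightarrow> (nat \<Rightarrow> real poly) \<Rightarrow> (nat \<Rightarrow> real) \<Rightarrow> bool" where
  "continued_fraction_expansion \<Phi> \<epsilon> p \<beta> \<longleftrightarrow>
     (\<forall>j. \<Phi> j meromorphic_on upper_half_plane \<and>
          \<bar>\<epsilon> j\<bar> = 1 \<and> first_asymptotic_coeff (\<Phi> j) (\<epsilon> j) \<and>
          lead_coeff (p j) = 1 \<and>
          (\<forall>\<delta>>0. (\<lambda>z. - 1 / \<Phi> j z - of_real (\<epsilon> j) * poly (map_poly of_real (p j)) z)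
             \<in> o[sector_infinity \<delta>](\<lambda>_. 1)) \<and>
          \<beta> j > 0 \<and>
          (\<forall>z\<in>upper_half_plane. \<Phi> j z \<noteq> 0 \<longrightarrow>
             - 1 / \<Phi> j z = of_real (\<epsilon> j) * poly (map_poly of_real (p j)) z
                             + of_real ((\<beta> j)\<^sup>2) * \<Phi> (j + 1) z))"

definition generalized_jacobi_matrix ::
    "(nat \<Rightarrow> nat) \<Rightarrow> (nat \<Rightarrow> real poly) \<Rightarrow> (nat \<Rightarrow> real) \<Rightarrow> inf_matrix" where
  "generalized_jacobi_matrix n p c = block_matrix n (\<lambda>i j.
     if i = j then
       (if block_size n i = 1 then explicit_block [[- coeff (p i) 0]]
        else explicit_block [[0, 1], [- coeff (p i) 0, - coeff (p i) 1]])
     else if j = i + 1 then lower_left_block (block_size n i) 1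
     else if i = j + 1 then lower_left_block (block_size n i) (c j)
     else (\<lambda>_ _. 0))"

text \<open>Dividing by the modulus of the first nonzero coefficient \<open>s (normal_index s 1 - 1)\<close> does
  not change a normalized function, so both cases of the definition are covered. The normal
  indices are not affected by this division.\<close>

definition generalized_jacobi_matrix_of :: "(complex \<Rightarrow> complex) \<Rightarrow> inf_matrix \<Rightarrow> bool" where
  "generalized_jacobi_matrix_of F A \<longleftrightarrow>
     F \<in> D_plus_minus_inf \<union> D_minus_minus_inf \<and> \<not> rational_function F \<and>
     (\<exists>s \<Phi> \<epsilon> p \<beta>. has_asymptotics F s \<and>
        \<Phi> 0 = (\<lambda>z. F z / of_real \<bar>first_nonzero s\<bar>) \<and>
        continued_fraction_expansion \<Phi> \<epsilon> p \<beta> \<and>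
        (\<forall>j. degree (p j) = block_size (normal_index s) j) \<and>
        A = generalized_jacobi_matrix (normal_index s) p (\<lambda>j. \<epsilon> j * \<epsilon> (j + 1) * (\<beta> j)\<^sup>2))"

end

theory Submission
  imports Defs
begin

text \<open>Let \<open>R\<close> be the column of the functions \<open>R j z = (LINT t|\<sigma>. P j t / (t - z)) = P j z * F z + Q j z\<close>
  and \<open>P_hat\<close> the column of the numbers \<open>P_hat j 0\<close>. Since \<open>J R = z R + s\<^sub>0 e\<^sub>0\<close> and
  \<open>J P_hat = s\<^sub>0 e\<^sub>0\<close>, one has \<open>J (R - P_hat) = z R\<close>; hence \<open>W = L (R - P_hat) / z\<close> satisfies
  \<open>U W = R\<close> and \<open>L U W = L R = z W + L P_hat\<close>, where \<open>L P_hat\<close> is supported in the first block. So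
  \<open>W\<close> is a solution of the recurrence of the matrix \<open>L U\<close> with first entry \<open>F z / z - s\<^sub>-\<^sub>1 / z\<close>.
  Its block components decay as \<open>z\<close> to the power minus the next normal index, and ratios of consecutive ones
  are, up to constants, the functions of the continued fraction.\<close>

section \<open>Expansions in sectors\<close>

text \<open>The prescribed \<open>l\<close> makes \<open>L P_hat\<close> vanish beyond the first
  block: its last entry in each later block cancels by the choice of \<open>l\<close>, and in a
  block of size 2 the first entry is \<open>P_hat (n j) 0 = 0\<close>, since the normal indices skip
  exactly the zeros of \<open>P_hat k 0\<close>. Behind this is that \<open>P_hat k 0\<close> equals
  the moment functional of the sequence starting with \<open>sm\<close>, applied to
  \<open>P k\<close>. The parameters \<open>u\<close> and \<open>e\<close> are known only through
  \<open>J = U L\<close>. Comparing single entries of this product ties them, together with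
  \<open>l\<close>, to the recurrence coefficients of \<open>P\<close>; associativity of infinite
  matrix products is never invoked. In a block of size 2 the first row of \<open>L U\<close> is a
  shift, so the second entry of \<open>W\<close> is \<open>z\<close> times the first. Hence only the
  first entries \<open>V j\<close> are followed, and they obey a scalar recurrence with the
  polynomials of the diagonal blocks. The inhomogeneous term of the first block is absorbed by a
  constant function -1 put in front of the \<open>V j\<close>. The signs of the leading coefficients
  of the \<open>V j\<close> supply the signs of the continued fraction.\<close>

no_notation vec_index (infixl \<open>$\<close> 100)
unbundle no vec_syntax and fps_syntax

text \<open>A complete asymptotic expansion in powers of \<open>1 / z\<close>. The coefficients form
  a formal power series, so that products and inverses of functions correspond to those in
  \<open>real fps\<close>. The remainder is O of the next power rather than o of the last one, which
  lets these rules follow by multiplying bounds.\<close>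

definition sector_expansion :: "(complex \<Rightarrow> complex) \<Rightarrow> real fps \<Rightarrow> bool" where
  "sector_expansion G f \<longleftrightarrow>
     (\<forall>n. \<forall>\<epsilon>>0. (\<lambda>z. G z - (\<Sum>i<n. of_real (f $ i) / z ^ i)) \<in> O[sector_infinity \<epsilon>](\<lambda>z. 1 / z ^ n))"

lemma sector_expansionD:
  assumes "sector_expansion G f" "\<epsilon> > 0"
  shows "(\<lambda>z. G z - (\<Sum>i<n. of_real (f $ i) / z ^ i)) \<in> O[sector_infinity \<epsilon>](\<lambda>z. 1 / z ^ n)"
  using assms unfolding sector_expansion_def by blast

section \<open>Estimates inside a sector\<close>

lemma open_upper_half_plane: "open upper_half_plane"
  unfolding upper_half_plane_def by (rule open_halfspace_Im_gt)

lemma upper_half_plane_nonzero: "z \<in> upper_half_plane \<Longrightarrow> z \<noteq> 0"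
  by (auto simp: upper_half_plane_def)

lemma eventually_sector_upper_half_plane:
  assumes "\<epsilon> > 0"
  shows "eventually (\<lambda>z. z \<in> upper_half_plane) (sector_infinity \<epsilon>)"
  unfolding sector_infinity_def eventually_inf_principal upper_half_plane_def
  using assms Arg_lt_pi by (intro always_eventually) fastforce

lemma eventually_sector_nonzero: "eventually (\<lambda>z. z \<noteq> 0) (sector_infinity \<epsilon>)"
  unfolding sector_infinity_def eventually_inf_principal
  by (rule eventually_mono[OF eventually_not_equal_at_infinity[of 0]]) auto

lemma filterlim_sector_infinity: "filterlim (\<lambda>z. z) at_infinity (sector_infinity \<epsilon>)"
  unfolding sector_infinity_def filterlim_def by simp

text \<open>The role of the sector: a bound by \<open>1 / Im z\<close>, the natural one for Cauchy
  transforms, becomes a bound by \<open>1 / norm z\<close>.\<close>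

lemma eventually_sector_Im_ge:
  assumes "\<epsilon> > 0"
  shows "eventually (\<lambda>z. Im z \<ge> sin \<epsilon> * norm z \<and> Im z > 0) (sector_infinity \<epsilon>)"
proof -
  have "Im z \<ge> sin \<epsilon> * norm z \<and> Im z > 0" if "\<epsilon> < Arg z" "Arg z < pi - \<epsilon>" for z
  proof -
    have pos: "Im z > 0" using that assms Arg_lt_pi[of z] by linarith
    then have "z \<noteq> 0" by auto
    have "sin (Arg z) \<ge> sin \<epsilon>"
    proof (cases "Arg z \<le> pi / 2")
      case True
      then show ?thesis using that assms by (intro sin_monotone_2pi_le) auto
    next
      case False
      have "sin (pi - Arg z) \<ge> sin \<epsilon>"
        using that assms False by (intro sin_monotone_2pi_le) (auto simp: field_simps)
      then show ?thesis by simp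
    qed
    moreover have "Im z = norm z * sin (Arg z)"
      using \<open>z \<noteq> 0\<close> by (simp add: sin_Arg)
    ultimately show ?thesis using pos mult_left_mono[of "sin \<epsilon>" "sin (Arg z)" "norm z"]
      by (simp add: mult.commute)
  qed
  then show ?thesis
    unfolding sector_infinity_def eventually_inf_principal
    by (intro always_eventually) auto
qed

lemma bigo_sector_inverse_power:
  assumes "m \<le> n"
  shows "(\<lambda>z. 1 / z ^ n) \<in> O[sector_infinity \<epsilon>](\<lambda>z. 1 / z ^ m)"
proof -
  have "eventually (\<lambda>z::complex. norm z \<ge> 1) at_infinity"
    by (auto simp: eventually_at_infinity)
  then have "eventually (\<lambda>z. norm z \<ge> 1) (sector_infinity \<epsilon>)"
    unfolding sector_infinity_def eventually_inf_principal by (rule eventually_mono) auto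
  then have "eventually (\<lambda>z. norm (1 / z ^ n) \<le> 1 * norm (1 / z ^ m)) (sector_infinity \<epsilon>)"
  proof eventually_elim
    case (elim z)
    have "0 < norm z ^ m" using elim by (intro zero_less_power) linarith
    moreover have "norm z ^ m \<le> norm z ^ n" using elim assms by (intro power_increasing)
    ultimately show ?case by (simp add: norm_divide norm_power frac_le)
  qed
  then show ?thesis by (rule bigoI)
qed

lemma smallo_sector_inverse_power:
  assumes "m < n"
  shows "(\<lambda>z. 1 / z ^ n) \<in> o[sector_infinity \<epsilon>](\<lambda>z. 1 / z ^ m)"
proof -
  have "(\<lambda>z. 1 / z) \<in> o[sector_infinity \<epsilon>](\<lambda>_. 1)"
    using tendsto_inverse_0[THEN filterlim_compose[OF _ filterlim_sector_infinity]]
    by (intro smalloI_tendsto) (auto simp: divide_inverse)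
  moreover have "(\<lambda>z. 1 / z ^ (n - 1)) \<in> O[sector_infinity \<epsilon>](\<lambda>z. 1 / z ^ m)"
    using assms by (intro bigo_sector_inverse_power) auto
  ultimately have "(\<lambda>z. (1 / z) * (1 / z ^ (n - 1))) \<in> o[sector_infinity \<epsilon>](\<lambda>z. 1 * (1 / z ^ m))"
    by (rule landau_o.small_big_mult)
  moreover have "(1 / z) * (1 / z ^ (n - 1)) = 1 / z ^ n" for z :: complex
    using assms by (cases n) auto
  ultimately show ?thesis by simp
qed

section \<open>Calculus of expansions: sums, shifts, products, inverses\<close>

lemma sector_expansion_cong:
  assumes "sector_expansion G f" "\<And>z. z \<in> upper_half_plane \<Longrightarrow> G z = H z"
  shows "sector_expansion H f"
  unfolding sector_expansion_def
proof (intro allI impI)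
  fix n and \<epsilon> :: real assume "\<epsilon> > 0"
  then have "(\<lambda>z. G z - (\<Sum>i<n. of_real (f $ i) / z ^ i)) \<in> O[sector_infinity \<epsilon>](\<lambda>z. 1 / z ^ n)"
    using assms(1) by (simp add: sector_expansion_def)
  moreover have "eventually (\<lambda>z. G z = H z) (sector_infinity \<epsilon>)"
    using eventually_sector_upper_half_plane[OF \<open>\<epsilon> > 0\<close>] by eventually_elim (use assms(2) in auto)
  then have "eventually (\<lambda>z. G z - (\<Sum>i<n. of_real (f $ i) / z ^ i) =
       H z - (\<Sum>i<n. of_real (f $ i) / z ^ i)) (sector_infinity \<epsilon>)"
    by eventually_elim simp
  ultimately show "(\<lambda>z. H z - (\<Sum>i<n. of_real (f $ i) / z ^ i)) \<in> O[sector_infinity \<epsilon>](\<lambda>z. 1 / z ^ n)"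
    by (subst landau_o.big.in_cong[symmetric]) auto
qed

lemma sector_expansion_bigo_1:
  assumes "sector_expansion G f" "\<epsilon> > 0"
  shows "G \<in> O[sector_infinity \<epsilon>](\<lambda>_. 1)"
  using sector_expansionD[OF assms, of 0] by simp

lemma sector_expansion_one: "sector_expansion (\<lambda>_. 1) 1"
  unfolding sector_expansion_def
proof (intro allI impI)
  fix n and \<epsilon> :: real
  show "(\<lambda>z. 1 - (\<Sum>i<n. of_real ((1::real fps) $ i) / z ^ i)) \<in> O[sector_infinity \<epsilon>](\<lambda>z. 1 / z ^ n)"
  proof (cases n)
    case (Suc m)
    have "(\<Sum>i<n. of_real ((1::real fps) $ i) / z ^ i) = 1" for z :: complex
      unfolding Suc by (subst sum.lessThan_Suc_shift) simp
    then show ?thesis by simp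
  qed simp
qed

lemma sector_expansion_cmult:
  assumes "sector_expansion G f"
  shows "sector_expansion (\<lambda>z. of_real c * G z) (fps_const c * f)"
  unfolding sector_expansion_def
proof (intro allI impI)
  fix n and \<epsilon> :: real assume "\<epsilon> > 0"
  have "(\<lambda>z. of_real c * (G z - (\<Sum>i<n. of_real (f $ i) / z ^ i))) \<in> O[sector_infinity \<epsilon>](\<lambda>z. 1 / z ^ n)"
    using assms \<open>\<epsilon> > 0\<close> by (simp add: sector_expansion_def)
  then show "(\<lambda>z. of_real c * G z - (\<Sum>i<n. of_real ((fps_const c * f) $ i) / z ^ i))
      \<in> O[sector_infinity \<epsilon>](\<lambda>z. 1 / z ^ n)"
    by (simp add: right_diff_distrib sum_distrib_left)
qed

lemma sector_expansion_add:
  assumes "sector_expansion G f" "sector_expansion H g"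
  shows "sector_expansion (\<lambda>z. G z + H z) (f + g)"
  unfolding sector_expansion_def
proof (intro allI impI)
  fix n and \<epsilon> :: real assume "\<epsilon> > 0"
  have "(\<lambda>z. (G z - (\<Sum>i<n. of_real (f $ i) / z ^ i)) + (H z - (\<Sum>i<n. of_real (g $ i) / z ^ i)))
      \<in> O[sector_infinity \<epsilon>](\<lambda>z. 1 / z ^ n)"
    using assms \<open>\<epsilon> > 0\<close> by (intro sum_in_bigo(1)[OF sector_expansionD sector_expansionD])
  moreover have "(G z - (\<Sum>i<n. of_real (f $ i) / z ^ i)) + (H z - (\<Sum>i<n. of_real (g $ i) / z ^ i)) =
      G z + H z - (\<Sum>i<n. of_real ((f + g) $ i) / z ^ i)" for z
    by (simp add: add_divide_distrib sum.distrib)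
  ultimately show "(\<lambda>z. G z + H z - (\<Sum>i<n. of_real ((f + g) $ i) / z ^ i))
      \<in> O[sector_infinity \<epsilon>](\<lambda>z. 1 / z ^ n)"
    by simp
qed

lemma sector_expansion_sum:
  assumes "finite A" "\<And>i. i \<in> A \<Longrightarrow> sector_expansion (G i) (f i)"
  shows "sector_expansion (\<lambda>z. \<Sum>i\<in>A. G i z) (\<Sum>i\<in>A. f i)"
  using assms
proof (induction A rule: finite_induct)
  case empty
  show ?case using sector_expansion_cmult[OF sector_expansion_one, of 0] by simp
next
  case (insert x A)
  then show ?case by (simp add: sector_expansion_add)
qed

lemma sector_expansion_divide_var:
  assumes "sector_expansion G f"
  shows "sector_expansion (\<lambda>z. G z / z) (fps_X * f)"
  unfolding sector_expansion_def
proof (intro allI impI)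
  fix n and \<epsilon> :: real assume e: "\<epsilon> > 0"
  have inv: "(\<lambda>z. 1 / z) \<in> O[sector_infinity \<epsilon>](\<lambda>_. 1)"
    using bigo_sector_inverse_power[of 0 1] by simp
  show "(\<lambda>z. G z / z - (\<Sum>i<n. of_real ((fps_X * f) $ i) / z ^ i)) \<in> O[sector_infinity \<epsilon>](\<lambda>z. 1 / z ^ n)"
  proof (cases n)
    case 0
    then show ?thesis
      using landau_o.big_mult[OF sector_expansion_bigo_1[OF assms e] inv] by simp
  next
    case (Suc m)
    have "(\<lambda>z. (G z - (\<Sum>i<m. of_real (f $ i) / z ^ i)) * (1 / z)) \<in> O[sector_infinity \<epsilon>](\<lambda>z. (1 / z ^ m) * (1 / z))"
      using assms e unfolding sector_expansion_def by (intro landau_o.big_mult) auto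
    moreover have "(G z - (\<Sum>i<m. of_real (f $ i) / z ^ i)) * (1 / z) =
        G z / z - (\<Sum>i<n. of_real ((fps_X * f) $ i) / z ^ i)" for z
      unfolding Suc by (subst sum.lessThan_Suc_shift)
        (simp add: left_diff_distrib sum_distrib_right diff_divide_distrib sum_divide_distrib mult.commute)
    ultimately show ?thesis by (simp add: Suc mult.commute)
  qed
qed

lemma sector_expansion_divide_power:
  assumes "sector_expansion G f"
  shows "sector_expansion (\<lambda>z. G z / z ^ k) (fps_X ^ k * f)"
proof (induction k)
  case (Suc k)
  show ?case using sector_expansion_divide_var[OF Suc] by (simp add: ac_simps)
qed (use assms in simp)

lemma fps_cutoff_eq_sum: "fps_cutoff n f = (\<Sum>i<n. fps_const (f $ i) * fps_X ^ i)"
  by (rule fps_ext) (auto simp: fps_sum_nth fps_X_power_nth if_distrib[of "\<lambda>x. _ * x"] sum.delta cong: if_cong)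

text \<open>Only \<open>f\<close> is truncated, at order \<open>n\<close>. The discarded part of
  \<open>G\<close> is O of \<open>1 / z ^ n\<close> and \<open>H\<close> is bounded; the rest is a
  finite combination of the functions \<open>H z / z ^ i\<close>, whose expansion
  \<open>fps_cutoff n f * g\<close> agrees with \<open>f * g\<close> below \<open>n\<close>.\<close>

lemma sector_expansion_mult:
  assumes G: "sector_expansion G f" and H: "sector_expansion H g"
  shows "sector_expansion (\<lambda>z. G z * H z) (f * g)"
  unfolding sector_expansion_def
proof (intro allI impI)
  fix n and \<epsilon> :: real assume e: "\<epsilon> > 0"
  have "sector_expansion (\<lambda>z. \<Sum>i<n. of_real (f $ i) * (H z / z ^ i))
          (\<Sum>i<n. fps_const (f $ i) * (fps_X ^ i * g))"
    using H by (intro sector_expansion_sum sector_expansion_cmult sector_expansion_divide_power) auto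
  also have "(\<Sum>i<n. fps_const (f $ i) * (fps_X ^ i * g)) = fps_cutoff n f * g"
    by (simp add: fps_cutoff_eq_sum sum_distrib_right mult.assoc)
  finally have "(\<lambda>z. (\<Sum>i<n. of_real (f $ i) * (H z / z ^ i)) -
      (\<Sum>i<n. of_real ((fps_cutoff n f * g) $ i) / z ^ i)) \<in> O[sector_infinity \<epsilon>](\<lambda>z. 1 / z ^ n)"
    using e by (simp add: sector_expansion_def)
  moreover have "(\<lambda>z. (G z - (\<Sum>i<n. of_real (f $ i) / z ^ i)) * H z) \<in> O[sector_infinity \<epsilon>](\<lambda>z. 1 / z ^ n * 1)"
    using G e by (intro landau_o.big_mult sector_expansion_bigo_1[OF H]) (auto simp: sector_expansion_def)
  ultimately have "(\<lambda>z. (G z - (\<Sum>i<n. of_real (f $ i) / z ^ i)) * H z +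
      ((\<Sum>i<n. of_real (f $ i) * (H z / z ^ i)) - (\<Sum>i<n. of_real ((fps_cutoff n f * g) $ i) / z ^ i)))
      \<in> O[sector_infinity \<epsilon>](\<lambda>z. 1 / z ^ n)"
    by (intro sum_in_bigo(1)) (simp_all only: mult_1_right)
  then show "(\<lambda>z. G z * H z - (\<Sum>i<n. of_real ((f * g) $ i) / z ^ i)) \<in> O[sector_infinity \<epsilon>](\<lambda>z. 1 / z ^ n)"
    by (simp add: fps_cutoff_left_mult_nth left_diff_distrib sum_distrib_right)
qed

lemma sector_expansion_mult_power:
  assumes "sector_expansion G f" "\<And>i. i < k \<Longrightarrow> f $ i = 0"
  shows "sector_expansion (\<lambda>z. z ^ k * G z) (fps_shift k f)"
  unfolding sector_expansion_def
proof (intro allI impI)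
  fix n and \<epsilon> :: real assume e: "\<epsilon> > 0"
  have "(\<lambda>z. z ^ k * (G z - (\<Sum>i<n + k. of_real (f $ i) / z ^ i)))
      \<in> O[sector_infinity \<epsilon>](\<lambda>z. z ^ k * (1 / z ^ (n + k)))"
    using assms(1) e by (intro landau_o.big_mult) (auto simp: sector_expansion_def)
  moreover have "eventually (\<lambda>z. z ^ k * (1 / z ^ (n + k)) = 1 / z ^ n) (sector_infinity \<epsilon>)"
    using eventually_sector_nonzero by eventually_elim (simp add: power_add)
  moreover have "eventually (\<lambda>z. z ^ k * (G z - (\<Sum>i<n + k. of_real (f $ i) / z ^ i)) =
      z ^ k * G z - (\<Sum>i<n. of_real (fps_shift k f $ i) / z ^ i)) (sector_infinity \<epsilon>)"
    using eventually_sector_nonzero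
  proof eventually_elim
    case (elim z)
    have "(\<Sum>i<n + k. of_real (f $ i) / z ^ i) = (\<Sum>i<n. of_real (f $ (i + k)) / z ^ (i + k))"
    proof -
      have "(\<Sum>i<n + k. of_real (f $ i) / z ^ i) = (\<Sum>i\<in>{k..<n + k}. of_real (f $ i) / z ^ i)"
        using assms(2) by (intro sum.mono_neutral_right) (auto simp: not_le)
      also have "\<dots> = (\<Sum>i<n. of_real (f $ (i + k)) / z ^ (i + k))"
        using sum.shift_bounds_nat_ivl[of "\<lambda>i. of_real (f $ i) / z ^ i" 0 k n]
        by (simp add: atLeast0LessThan)
      finally show ?thesis .
    qed
    then show ?case using elim by (simp add: right_diff_distrib sum_distrib_left power_add)
  qed
  ultimately show "(\<lambda>z. z ^ k * G z - (\<Sum>i<n. of_real (fps_shift k f $ i) / z ^ i))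
      \<in> O[sector_infinity \<epsilon>](\<lambda>z. 1 / z ^ n)"
    by (simp only: landau_o.big.cong landau_o.big.in_cong)
qed

lemma sector_expansion_tendsto:
  assumes "sector_expansion G f" "\<epsilon> > 0"
  shows "(G \<longlongrightarrow> of_real (f $ 0)) (sector_infinity \<epsilon>)"
proof -
  have "(\<lambda>z. G z - of_real (f $ 0)) \<in> O[sector_infinity \<epsilon>](\<lambda>z. 1 / z ^ 1)"
    using sector_expansionD[OF assms, of 1] by simp
  from landau_o.big_small_trans[OF this smallo_sector_inverse_power[of 0 1]]
  have "((\<lambda>z. G z - of_real (f $ 0)) \<longlongrightarrow> 0) (sector_infinity \<epsilon>)"
    using smalloD_tendsto by fastforce
  then show ?thesis by (simp add: LIM_zero_iff)
qed

lemma sector_expansion_eventually_nonzero: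
  assumes "sector_expansion G f" "f $ 0 \<noteq> 0" "\<epsilon> > 0"
  shows "eventually (\<lambda>z. G z \<noteq> 0) (sector_infinity \<epsilon>)"
  using tendsto_imp_eventually_ne[OF sector_expansion_tendsto[OF assms(1,3)]] assms(2) by simp

text \<open>If \<open>T\<close> is the inverse series truncated at order \<open>n\<close>, then
  \<open>1 - G * T\<close> is O of \<open>1 / z ^ n\<close>, and multiplying this defect by the
  bounded function \<open>inverse G\<close> gives the error of \<open>T\<close>.\<close>

lemma sector_expansion_inverse:
  assumes G: "sector_expansion G f" and f0: "f $ 0 \<noteq> 0"
  shows "sector_expansion (\<lambda>z. inverse (G z)) (inverse f)"
  unfolding sector_expansion_def
proof (intro allI impI)
  fix n and \<epsilon> :: real assume e: "\<epsilon> > 0"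
  define T where "T z = (\<Sum>i<n. of_real (inverse f $ i) / z ^ i)" for z :: complex
  have "sector_expansion (\<lambda>z. \<Sum>i<n. of_real (inverse f $ i) * (1 / z ^ i))
          (\<Sum>i<n. fps_const (inverse f $ i) * (fps_X ^ i * 1))"
    by (intro sector_expansion_sum sector_expansion_cmult sector_expansion_divide_power
        sector_expansion_one) auto
  then have T: "sector_expansion T (fps_cutoff n (inverse f))"
    unfolding T_def fps_cutoff_eq_sum by simp
  have inv: "(\<lambda>z. inverse (G z)) \<in> O[sector_infinity \<epsilon>](\<lambda>_. 1)"
    using tendsto_inverse[OF sector_expansion_tendsto[OF G e]] f0
    by (intro bigoI_tendsto[where c = "inverse (of_real (f $ 0))"]) (auto simp: divide_inverse)
  have "sector_expansion (\<lambda>z. 1 + of_real (-1) * (G z * T z))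
          (1 + fps_const (-1) * (f * fps_cutoff n (inverse f)))"
    by (intro sector_expansion_add sector_expansion_one sector_expansion_cmult sector_expansion_mult G T)
  moreover have "(1 + fps_const (-1) * (f * fps_cutoff n (inverse f))) $ i = 0" if "i < n" for i
    using that inverse_mult_eq_1'[OF f0] by (simp add: fps_cutoff_right_mult_nth)
  ultimately have "(\<lambda>z. 1 - G z * T z) \<in> O[sector_infinity \<epsilon>](\<lambda>z. 1 / z ^ n)"
    using sector_expansionD[OF _ e, where n = n] by fastforce
  from landau_o.big_mult[OF this inv]
  have "(\<lambda>z. (1 - G z * T z) * inverse (G z)) \<in> O[sector_infinity \<epsilon>](\<lambda>z. 1 / z ^ n)"
    by simp
  moreover have "eventually (\<lambda>z. (1 - G z * T z) * inverse (G z) = inverse (G z) - T z) (sector_infinity \<epsilon>)"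
    using sector_expansion_eventually_nonzero[OF G f0 e]
    by eventually_elim (simp add: field_simps)
  ultimately show "(\<lambda>z. inverse (G z) - (\<Sum>i<n. of_real (inverse f $ i) / z ^ i))
      \<in> O[sector_infinity \<epsilon>](\<lambda>z. 1 / z ^ n)"
    unfolding T_def by (simp only: landau_o.big.in_cong)
qed

lemma sector_expansion_imp_has_asymptotics:
  assumes "sector_expansion G f" "f $ 0 = 0"
  shows "has_asymptotics G (\<lambda>j. - f $ Suc j)"
  unfolding has_asymptotics_def
proof (intro allI impI)
  fix n and \<epsilon> :: real assume e: "\<epsilon> > 0"
  \<comment> \<open>One order beyond what \<open>has_asymptotics\<close> looks at, since O of
    \<open>1 / z ^ (2 * n + 2)\<close> is o of \<open>1 / z ^ (2 * n + 1)\<close>.\<close>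
  have "(\<lambda>z. G z - (\<Sum>i<2 * n + 2. of_real (f $ i) / z ^ i)) \<in> O[sector_infinity \<epsilon>](\<lambda>z. 1 / z ^ (2 * n + 2))"
    by (rule sector_expansionD[OF assms(1) e])
  from landau_o.big_small_trans[OF this smallo_sector_inverse_power[of "2 * n + 1"]]
  have "(\<lambda>z. G z - (\<Sum>i<2 * n + 2. of_real (f $ i) / z ^ i)) \<in> o[sector_infinity \<epsilon>](\<lambda>z. 1 / z ^ (2 * n + 1))"
    by simp
  moreover have "(\<Sum>i<2 * n + 2. of_real (f $ i) / z ^ i) =
      - (\<Sum>j\<le>2 * n. of_real (- f $ Suc j) / z ^ (j + 1))" for z :: complex
    using assms(2) sum.lessThan_Suc_shift[of "\<lambda>i. of_real (f $ i) / z ^ i" "2 * n + 1"]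
    by (simp add: sum_negf lessThan_Suc_atMost)
  ultimately show "(\<lambda>z. G z - (- (\<Sum>j\<le>2 * n. of_real (- f $ Suc j) / z ^ (j + 1))))
      \<in> o[sector_infinity \<epsilon>](\<lambda>z. 1 / z ^ (2 * n + 1))"
    by simp
qed

section \<open>Block factors\<close>

locale block_partition =
  fixes n :: "nat \<Rightarrow> nat"
  assumes start: "n 0 = 0"
    and step: "n (Suc j) = n j + 1 \<or> n (Suc j) = n j + 2"
begin

lemma block_size_cases:
  obtains "block_size n j = 1" "n (Suc j) = n j + 1" | "block_size n j = 2" "n (Suc j) = n j + 2"
  using step[of j] by (auto simp: block_size_def)

lemma strict_mono: "strict_mono n"
  unfolding strict_mono_Suc_iff
proof
  fix j show "n j < n (Suc j)" using step[of j] by linarith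
qed

lemma less_Suc_block: "n j < n (Suc j)"
  using strict_mono unfolding strict_mono_Suc_iff by blast

lemma start_pos: "j > 0 \<Longrightarrow> n j > 0"
  using strict_mono_less[OF strict_mono, of 0 j] start by simp

lemma block_of_add:
  assumes "a < block_size n j"
  shows "block_of n (n j + a) = j"
  unfolding block_of_def
proof (rule Least_equality)
  show "n j + a < n (j + 1)" using assms by (simp add: block_size_def)
next
  fix i assume "n j + a < n (i + 1)"
  then have "n j < n (Suc i)" by simp
  then show "j \<le> i" using strict_mono_less[OF strict_mono] by fastforce
qed

lemma index_cases:
  obtains j a where "r = n j + a" "a < block_size n j"
proof -
  have "r < n (Suc r)" using strict_mono_imp_increasing[OF strict_mono, of "Suc r"] by simp
  define j where "j = (LEAST j. r < n (Suc j))"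
  have *: "r < n (Suc j)" unfolding j_def using \<open>r < n (Suc r)\<close> by (rule LeastI)
  have "n j \<le> r"
  proof (cases j)
    case (Suc i)
    then show ?thesis using not_less_Least[of i "\<lambda>j. r < n (Suc j)"] by (simp add: j_def)
  qed (simp add: start)
  with * show ?thesis by (intro that[of j "r - n j"]) (auto simp: block_size_def)
qed

lemma index_eq_iff:
  assumes "a < block_size n i" "b < block_size n j"
  shows "n i + a = n j + b \<longleftrightarrow> i = j \<and> a = b"
proof
  assume eq: "n i + a = n j + b"
  then have "i = j" using block_of_add[OF assms(1)] block_of_add[OF assms(2)] by simp
  with eq show "i = j \<and> a = b" by simp
qed simp

lemma block_matrix_entry:
  assumes "a < block_size n i" "b < block_size n j"
  shows "block_matrix n B (n i + a) (n j + b) = B i j a b"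
  using assms by (simp add: block_matrix_def block_of_add)

lemma last_index: "n (Suc j) - 1 = n j + (block_size n j - 1)" "block_size n j - 1 < block_size n j"
  using less_Suc_block[of j] by (auto simp: block_size_def)

lemma block_size_pos: "0 < block_size n j"
  using less_Suc_block[of j] by (auto simp: block_size_def)

lemma index_eq_start_iff:
  assumes "a < block_size n i"
  shows "n i + a = n j \<longleftrightarrow> i = j \<and> a = 0"
  using index_eq_iff[OF assms block_size_pos[of j]] by simp

lemma index_eq_last_iff:
  assumes "a < block_size n i"
  shows "n i + a = n (Suc j) - 1 \<longleftrightarrow> i = j \<and> a = block_size n j - 1"
  using index_eq_iff[OF assms last_index(2)[of j]] by (simp only: last_index(1))

lemma index_eq_second_iff:
  assumes "a < block_size n i" "block_size n j = 2"
  shows "n i + a = Suc (n j) \<longleftrightarrow> i = j \<and> a = 1"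
  using index_eq_iff[OF assms(1), of 1 j] assms(2) by simp

lemma block_matrix_last_row:
  assumes "b < block_size n j"
  shows "block_matrix n B (n (Suc i) - 1) (n j + b) = B i j (block_size n i - 1) b"
  using block_matrix_entry[OF last_index(2)[of i] assms] by (simp only: last_index(1))

lemma block_matrix_first_row:
  assumes "b < block_size n j"
  shows "block_matrix n B (n i) (n j + b) = B i j 0 b"
  using block_matrix_entry[OF block_size_pos[of i] assms, of B] by simp

text \<open>Rows are addressed by the last row of each block, which is the only one in a block of
  size 1; the first row of a block of size 2 is treated separately.\<close>

lemma upper_factor_last_row:
  "upper_factor n u (n (Suc i) - 1) c = (if c = n i then u i else if c = n (Suc i) then 1 else 0)"
proof -
  obtain j b where c: "c = n j + b" and b: "b < block_size n j" by (rule index_cases)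
  show ?thesis
    unfolding upper_factor_def c block_matrix_last_row[OF b] index_eq_start_iff[OF b]
    using b by (cases rule: block_size_cases[of i])
      (auto simp: explicit_block_def lower_left_block_def less_Suc_eq numeral_2_eq_2)
qed

lemma upper_factor_first_row:
  assumes "block_size n i = 2"
  shows "upper_factor n u (n i) c = (if c = Suc (n i) then 1 else 0)"
proof -
  obtain j b where c: "c = n j + b" and b: "b < block_size n j" by (rule index_cases)
  show ?thesis
    unfolding upper_factor_def c block_matrix_first_row[OF b] index_eq_second_iff[OF b assms]
    using assms b by (auto simp: explicit_block_def lower_left_block_def less_Suc_eq numeral_2_eq_2)
qed

text \<open>The order of the tests matters: in a block of size 1 the first two columns coincide and
  \<open>e i\<close> drops out. The guard \<open>i > 0\<close> excludes \<open>n 0 - 1\<close>,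
  which is 0 in the naturals.\<close>

lemma lower_factor_last_row:
  "lower_factor n e l (n (Suc i) - 1) c =
     (if c = n (Suc i) - 1 then 1 else if c = n i then e i
      else if i > 0 \<and> c = n i - 1 then l i else 0)"
proof -
  obtain j b where c: "c = n j + b" and b: "b < block_size n j" by (rule index_cases)
  have prev: "i > 0 \<and> n j + b = n i - 1 \<longleftrightarrow> i = Suc j \<and> b = block_size n j - 1"
    using index_eq_last_iff[OF b, of "i - 1"] by (cases i) auto
  show ?thesis
    unfolding lower_factor_def c block_matrix_last_row[OF b] index_eq_start_iff[OF b]
      index_eq_last_iff[OF b] prev
    using b by (cases rule: block_size_cases[of i])
      (auto simp: explicit_block_def lower_right_block_def less_Suc_eq numeral_2_eq_2)
qed

lemma lower_factor_first_row:
  "lower_factor n e l (n i) c =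
     (if c = n i then 1 else if block_size n i = 1 \<and> i > 0 \<and> c = n i - 1 then l i else 0)"
proof (cases rule: block_size_cases[of i])
  case 1
  then show ?thesis using lower_factor_last_row[of e l i c] by simp
next
  case 2
  obtain j b where c: "c = n j + b" and b: "b < block_size n j" by (rule index_cases)
  show ?thesis
    unfolding lower_factor_def c block_matrix_first_row[OF b] index_eq_start_iff[OF b]
    using b 2 by (auto simp: explicit_block_def lower_right_block_def less_Suc_eq numeral_2_eq_2)
qed

lemmas factor_last_row = upper_factor_last_row[unfolded One_nat_def]
  lower_factor_last_row[unfolded One_nat_def]

lemma generalized_jacobi_matrix_last_row:
  "generalized_jacobi_matrix n p d (n (Suc i) - 1) c =
     (if c = n i then - coeff (p i) 0
      else if c = n (Suc i) then 1
      else if block_size n i = 2 \<and> c = Suc (n i) then - coeff (p i) 1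
      else if i > 0 \<and> c = n (i - 1) then d (i - 1) else 0)"
proof -
  obtain j b where c: "c = n j + b" and b: "b < block_size n j" by (rule index_cases)
  have second: "block_size n i = 2 \<and> n j + b = Suc (n i) \<longleftrightarrow> block_size n i = 2 \<and> j = i \<and> b = 1"
    using index_eq_second_iff[OF b] by auto
  show ?thesis
    unfolding generalized_jacobi_matrix_def c block_matrix_last_row[OF b] index_eq_start_iff[OF b] second
    using b by (cases rule: block_size_cases[of i])
      (auto simp: explicit_block_def lower_left_block_def less_Suc_eq numeral_2_eq_2)
qed

lemma generalized_jacobi_matrix_first_row:
  assumes "block_size n i = 2"
  shows "generalized_jacobi_matrix n p d (n i) c = (if c = Suc (n i) then 1 else 0)"
proof -
  obtain j b where c: "c = n j + b" and b: "b < block_size n j" by (rule index_cases)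
  show ?thesis
    unfolding generalized_jacobi_matrix_def c block_matrix_first_row[OF b]
      index_eq_second_iff[OF b assms]
    using assms b by (auto simp: explicit_block_def lower_left_block_def less_Suc_eq numeral_2_eq_2)
qed

end

section \<open>Products of the two factors and comparison with the Jacobi matrix\<close>

lemma inf_matrix_mult_finite_row:
  assumes "finite S" "\<And>k. k \<notin> S \<Longrightarrow> A i k = 0"
  shows "(A \<star> B) i j = (\<Sum>k\<in>S. A i k * B k j)"
  unfolding inf_matrix_mult_def using assms by (intro suminf_finite) auto

context block_partition
begin

lemma UL_last_row:
  "(upper_factor n u \<star> M) (n (Suc i) - 1) c = u i * M (n i) c + M (n (Suc i)) c"
  using less_Suc_block[of i]
  by (subst inf_matrix_mult_finite_row[where S = "{n i, n (Suc i)}"])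
    (auto simp: factor_last_row)

lemma UL_first_row:
  assumes "block_size n i = 2"
  shows "(upper_factor n u \<star> M) (n i) c = M (Suc (n i)) c"
  by (subst inf_matrix_mult_finite_row[where S = "{Suc (n i)}"])
    (auto simp: upper_factor_first_row[OF assms])

lemma LU_last_row:
  "(lower_factor n e l \<star> M) (n (Suc i) - 1) c =
     M (n (Suc i) - 1) c + (if block_size n i = 2 then e i * M (n i) c else 0) +
     (if i > 0 then l i * M (n i - 1) c else 0)"
proof -
  have "(lower_factor n e l \<star> M) (n (Suc i) - 1) c =
      (\<Sum>k\<in>{n (Suc i) - 1, n i, n i - 1}. lower_factor n e l (n (Suc i) - 1) k * M k c)"
    by (rule inf_matrix_mult_finite_row) (auto simp: factor_last_row)
  \<comment> \<open>The three summation indices need not be distinct: the first two agree in a block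
    of size 1, the last two for \<open>i = 0\<close>.\<close>
  also have "\<dots> = M (n (Suc i) - 1) c + (if block_size n i = 2 then e i * M (n i) c else 0) +
     (if i > 0 then l i * M (n i - 1) c else 0)"
    unfolding lower_factor_last_row using start start_pos[of i]
    by (cases rule: block_size_cases[of i]; cases "i = 0") auto
  finally show ?thesis .
qed

lemma LU_first_row:
  assumes "block_size n i = 2"
  shows "(lower_factor n e l \<star> M) (n i) c = M (n i) c"
  using assms by (subst inf_matrix_mult_finite_row[where S = "{n i}"])
    (auto simp: lower_factor_first_row)

text \<open>The characteristic polynomial of diagonal block \<open>i\<close> of \<open>L U\<close>.
  Its lower left entry \<open>x\<close> receives \<open>u i\<close> from the block itself and
  \<open>l i\<close> from the superdiagonal 1 in the preceding block row of \<open>U\<close>.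
  Nothing precedes block 0, and \<open>l 0\<close> is a meaningless value because
  \<open>n 0 - 1 = 0\<close>.\<close>

definition jacobi_polynomial :: "(nat \<Rightarrow> real) \<Rightarrow> (nat \<Rightarrow> real) \<Rightarrow> (nat \<Rightarrow> real) \<Rightarrow> nat \<Rightarrow> real poly" where
  "jacobi_polynomial u e l i =
     (let x = u i + (if i = 0 then 0 else l i)
      in if block_size n i = 1 then [:- x, 1:] else [:- x, - e i, 1:])"

lemma degree_jacobi_polynomial: "degree (jacobi_polynomial u e l i) = block_size n i"
  by (cases rule: block_size_cases[of i]) (auto simp: jacobi_polynomial_def Let_def)

lemma lead_coeff_jacobi_polynomial: "lead_coeff (jacobi_polynomial u e l i) = 1"
  by (cases rule: block_size_cases[of i]) (auto simp: jacobi_polynomial_def Let_def)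

lemma LU_eq_generalized_jacobi_matrix:
  "lower_factor n e l \<star> upper_factor n u =
     generalized_jacobi_matrix n (jacobi_polynomial u e l) (\<lambda>j. l (Suc j) * u j)"
proof (intro ext)
  fix r c
  obtain i a where r: "r = n i + a" and a: "a < block_size n i" by (rule index_cases)
  consider "r = n (Suc i) - 1" | "r = n i" "block_size n i = 2"
    using a r by (cases rule: block_size_cases[of i]) (auto simp: less_Suc_eq numeral_2_eq_2)
  then show "(lower_factor n e l \<star> upper_factor n u) r c =
     generalized_jacobi_matrix n (jacobi_polynomial u e l) (\<lambda>j. l (Suc j) * u j) r c"
  proof cases
    case 1
    have *: "upper_factor n u (n i - 1) c = (if c = n (i - 1) then u (i - 1) else if c = n i then 1 else 0)"
      if "i > 0" for c using that upper_factor_last_row[of u "i - 1" c] by simp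
    have less: "i > 0 \<Longrightarrow> n (i - 1) < n i" using less_Suc_block[of "i - 1"] by simp
    show ?thesis
      unfolding 1 LU_last_row generalized_jacobi_matrix_last_row upper_factor_last_row
      using less less_Suc_block[of i]
      by (cases rule: block_size_cases[of i])
        (auto simp: *[unfolded One_nat_def] upper_factor_first_row jacobi_polynomial_def)
  next
    case 2
    then show ?thesis
      by (simp add: LU_first_row upper_factor_first_row generalized_jacobi_matrix_first_row)
  qed
qed

text \<open>Row \<open>n j\<close> of \<open>U L\<close> is \<open>u j\<close> times row
  \<open>n j\<close> of \<open>L\<close> plus row \<open>n (Suc j)\<close> of \<open>L\<close>. The
  latter reaches back to column \<open>n j\<close> only if the next block has size 1; otherwise its
  \<open>l\<close> sits one row lower.\<close>

lemma jacobi_UL_single_block: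
  assumes J: "jacobi_matrix b c = upper_factor n u \<star> lower_factor n e l" and 1: "block_size n j = 1"
  shows "b (n j) = u j + (if block_size n (Suc j) = 1 then l (Suc j) else 0)"
    and "j > 0 \<Longrightarrow> c (n j - 1) = u j * l j"
proof -
  have s: "n (Suc j) = Suc (n j)" using 1 by (cases rule: block_size_cases[of j]) auto
  have row: "jacobi_matrix b c (n j) k = u j * lower_factor n e l (n j) k + lower_factor n e l (n (Suc j)) k" for k
    unfolding J using UL_last_row[of u "lower_factor n e l" j k] s by simp
  show "b (n j) = u j + (if block_size n (Suc j) = 1 then l (Suc j) else 0)"
    using row[of "n j", unfolded lower_factor_first_row] s by (simp add: jacobi_matrix_def)
  show "c (n j - 1) = u j * l j" if pos: "j > 0"
  proof -
    obtain m where "n j = Suc m" using start_pos[OF pos] gr0_conv_Suc by blast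
    then show ?thesis
      using row[of m, unfolded lower_factor_first_row] s pos 1 by (simp add: jacobi_matrix_def)
  qed
qed

text \<open>The first row of \<open>U\<close> in such a block selects the second row of
  \<open>L\<close> there, whence \<open>b (n j)\<close> and \<open>c (n j - 1)\<close>; the last row
  gives the other two identities.\<close>

lemma jacobi_UL_double_block:
  assumes J: "jacobi_matrix b c = upper_factor n u \<star> lower_factor n e l" and 2: "block_size n j = 2"
  shows "b (n j) = e j" "c (n j) = u j"
    and "b (Suc (n j)) = (if block_size n (Suc j) = 1 then l (Suc j) else 0)"
    and "j > 0 \<Longrightarrow> c (n j - 1) = l j"
proof -
  have s: "n (Suc j) = Suc (Suc (n j))" using 2 by (cases rule: block_size_cases[of j]) auto
  have last: "jacobi_matrix b c (Suc (n j)) k = u j * lower_factor n e l (n j) k + lower_factor n e l (n (Suc j)) k" for k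
    unfolding J using UL_last_row[of u "lower_factor n e l" j k] s by simp
  have first: "jacobi_matrix b c (n j) k = lower_factor n e l (Suc (n j)) k" for k
    unfolding J using UL_first_row[OF 2, of u "lower_factor n e l" k] .
  have row: "lower_factor n e l (Suc (n j)) k = (if k = Suc (n j) then 1 else if k = n j then e j
      else if j > 0 \<and> k = n j - 1 then l j else 0)" for k
    using lower_factor_last_row[of e l j k] s by simp
  show "b (n j) = e j" using first[of "n j"] by (simp add: jacobi_matrix_def row)
  show "c (n j) = u j" using last[of "n j", unfolded lower_factor_first_row] s 2 by (simp add: jacobi_matrix_def)
  show "b (Suc (n j)) = (if block_size n (Suc j) = 1 then l (Suc j) else 0)"
    using last[of "Suc (n j)", unfolded lower_factor_first_row] s 2 by (simp add: jacobi_matrix_def)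
  show "c (n j - 1) = l j" if pos: "j > 0"
  proof -
    obtain m where "n j = Suc m" using start_pos[OF pos] gr0_conv_Suc by blast
    then show ?thesis using first[of m, unfolded row] pos by (simp add: jacobi_matrix_def)
  qed
qed

end

section \<open>Moments and orthogonal polynomials\<close>

text \<open>The moment functional, sending \<open>t ^ i\<close> to \<open>s i\<close>. It is needed
  beyond integrals because the sequence starting with \<open>sm\<close> need not consist of moments
  of a measure.\<close>

definition sequence_functional :: "(nat \<Rightarrow> real) \<Rightarrow> real poly \<Rightarrow> real" where
  "sequence_functional s p = (\<Sum>i\<le>degree p. coeff p i * s i)"

lemma sequence_functional_altdef:
  assumes "degree p < n"
  shows "sequence_functional s p = (\<Sum>i<n. coeff p i * s i)"
  unfolding sequence_functional_def using assms
  by (intro sum.mono_neutral_left) (auto simp: coeff_eq_0)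

lemma sequence_functional_add:
  "sequence_functional s (p + q) = sequence_functional s p + sequence_functional s q"
proof -
  define n where "n = Suc (max (degree p) (degree q))"
  have "degree (p + q) < n" "degree p < n" "degree q < n"
    using degree_add_le_max[of p q] by (auto simp: n_def)
  then show ?thesis
    by (simp add: sequence_functional_altdef[where n = n] distrib_right sum.distrib)
qed

lemma sequence_functional_smult:
  "sequence_functional s (smult a p) = a * sequence_functional s p"
proof -
  have "degree (smult a p) < Suc (degree p)" using degree_smult_le[of a p] by simp
  then have "sequence_functional s (smult a p) = (\<Sum>i<Suc (degree p). coeff (smult a p) i * s i)"
    by (rule sequence_functional_altdef)
  then show ?thesis
    by (simp add: sequence_functional_def lessThan_Suc_atMost sum_distrib_left mult.assoc)
qed

lemma sequence_functional_diff:
  "sequence_functional s (p - q) = sequence_functional s p - sequence_functional s q"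
  using sequence_functional_add[of s "p - q" q] by simp

lemma sequence_functional_pCons:
  "sequence_functional s (pCons a p) = a * s 0 + sequence_functional (\<lambda>i. s (Suc i)) p"
proof -
  have "degree (pCons a p) < Suc (Suc (degree p))" using degree_pCons_le[of a p] by simp
  then have "sequence_functional s (pCons a p) = (\<Sum>i<Suc (Suc (degree p)). coeff (pCons a p) i * s i)"
    by (rule sequence_functional_altdef)
  also have "\<dots> = a * s 0 + (\<Sum>i<Suc (degree p). coeff p i * s (Suc i))"
    by (subst sum.lessThan_Suc_shift) simp
  finally show ?thesis by (simp add: sequence_functional_def lessThan_Suc_atMost)
qed

lemma sequence_functional_0 [simp]: "sequence_functional s 0 = 0"
  by (simp add: sequence_functional_def)

lemma sequence_functional_sum:
  "sequence_functional s (\<Sum>i\<in>A. f i) = (\<Sum>i\<in>A. sequence_functional s (f i))"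
  by (induction A rule: infinite_finite_induct) (simp_all add: sequence_functional_add)

lemma sequence_functional_monom_mult:
  "sequence_functional s (monom 1 i * p) = sequence_functional (\<lambda>k. s (i + k)) p"
proof (induction i arbitrary: s)
  case (Suc i)
  have "monom 1 (Suc i) * p = pCons 0 (monom 1 i * p)" by (simp add: monom_Suc)
  then show ?case using Suc by (simp add: sequence_functional_pCons)
qed simp

text \<open>A kernel vector of the Hankel matrix is read as the coefficients of \<open>q\<close>;
  row \<open>i\<close> of the product is then the functional applied to
  \<open>t ^ i * q\<close>.\<close>

lemma hankel_det_eq_0_iff:
  "hankel_det s n = 0 \<longleftrightarrow>
     (\<exists>q. q \<noteq> 0 \<and> degree q < n \<and> (\<forall>i<n. sequence_functional s (monom 1 i * q) = 0))"
proof -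
  define A where "A = Matrix.mat n n (\<lambda>(i, k). s (i + k))"
  have A: "A \<in> carrier_mat n n" by (simp add: A_def)
  have prod: "A *\<^sub>v v = 0\<^sub>v n \<longleftrightarrow> (\<forall>i<n. sequence_functional s (monom 1 i * q) = 0)"
    if v: "v \<in> carrier_vec n" and q: "degree q < n" "\<And>k. k < n \<Longrightarrow> coeff q k = vec_index v k" for v q
  proof -
    have "vec_index (A *\<^sub>v v) i = sequence_functional s (monom 1 i * q)" if "i < n" for i
    proof -
      have "vec_index (A *\<^sub>v v) i = (\<Sum>k<n. s (i + k) * vec_index v k)"
        using that v by (simp add: A_def scalar_prod_def atLeast0LessThan)
      also have "\<dots> = (\<Sum>k<n. coeff q k * s (i + k))"
        using q(2) by (intro sum.cong) auto
      finally show ?thesis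
        by (simp add: sequence_functional_monom_mult sequence_functional_altdef[OF q(1)])
    qed
    moreover have "A *\<^sub>v v = 0\<^sub>v n \<longleftrightarrow> (\<forall>i<n. vec_index (A *\<^sub>v v) i = 0)"
    proof
      assume *: "\<forall>i<n. vec_index (A *\<^sub>v v) i = 0"
      show "A *\<^sub>v v = 0\<^sub>v n"
        by (rule eq_vecI) (use * A in \<open>simp_all del: index_mult_mat_vec\<close>)
    qed simp
    ultimately show ?thesis by simp
  qed
  have "hankel_det s n = 0 \<longleftrightarrow> (\<exists>v. v \<in> carrier_vec n \<and> v \<noteq> 0\<^sub>v n \<and> A *\<^sub>v v = 0\<^sub>v n)"
    unfolding hankel_det_def A_def[symmetric] by (rule det_0_iff_vec_prod_zero[OF A])
  also have "\<dots> \<longleftrightarrow> (\<exists>q. q \<noteq> 0 \<and> degree q < n \<and> (\<forall>i<n. sequence_functional s (monom 1 i * q) = 0))"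
  proof
    assume "\<exists>v. v \<in> carrier_vec n \<and> v \<noteq> 0\<^sub>v n \<and> A *\<^sub>v v = 0\<^sub>v n"
    then obtain v where v: "v \<in> carrier_vec n" "v \<noteq> 0\<^sub>v n" "A *\<^sub>v v = 0\<^sub>v n" by blast
    define q where "q = Poly (list_of_vec v)"
    have co: "coeff q k = (if k < n then vec_index v k else 0)" for k
      using v(1) by (simp add: q_def nth_default_def list_of_vec_index)
    have "q \<noteq> 0"
    proof
      assume "q = 0"
      then have "vec_index v k = 0" if "k < n" for k using co[of k] that by simp
      with v(1,2) show False by (auto simp: vec_eq_iff)
    qed
    moreover have "degree q < n"
      using co[of "degree q"] \<open>q \<noteq> 0\<close> leading_coeff_neq_0 by (metis)
    ultimately show "\<exists>q. q \<noteq> 0 \<and> degree q < n \<and> (\<forall>i<n. sequence_functional s (monom 1 i * q) = 0)"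
      using prod[OF v(1), of q] co v(3) by auto
  next
    assume "\<exists>q. q \<noteq> 0 \<and> degree q < n \<and> (\<forall>i<n. sequence_functional s (monom 1 i * q) = 0)"
    then obtain q where q: "q \<noteq> 0" "degree q < n" "\<forall>i<n. sequence_functional s (monom 1 i * q) = 0" by blast
    define v where "v = Matrix.vec n (coeff q)"
    have v: "v \<in> carrier_vec n" "\<And>k. k < n \<Longrightarrow> coeff q k = vec_index v k" by (simp_all add: v_def)
    have "v \<noteq> 0\<^sub>v n"
    proof
      assume "v = 0\<^sub>v n"
      then have "coeff q (degree q) = 0" using v(2)[OF q(2)] q(2) by simp
      then show False using q(1) by simp
    qed
    then show "\<exists>v. v \<in> carrier_vec n \<and> v \<noteq> 0\<^sub>v n \<and> A *\<^sub>v v = 0\<^sub>v n"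
      using prod[OF v(1) q(2) v(2)] q(3) v(1) by blast
  qed
  finally show ?thesis .
qed

section \<open>Integrals and Cauchy transforms of polynomials\<close>

locale moment_measure =
  fixes \<sigma> :: "real measure"
  assumes sets: "sets \<sigma> = sets borel"
    and integrable_power: "integrable \<sigma> (\<lambda>t. t ^ j)"
begin

lemma measurable_borel: "f \<in> borel_measurable borel \<Longrightarrow> f \<in> borel_measurable \<sigma>"
  using measurable_cong_sets[OF sets refl] by blast

lemma integrable_poly: "integrable \<sigma> (poly p)"
proof -
  have "integrable \<sigma> (\<lambda>t. \<Sum>i\<le>degree p. coeff p i * t ^ i)"
    using integrable_power by (intro Bochner_Integration.integrable_sum integrable_mult_right) auto
  then show ?thesis by (simp add: poly_altdef[abs_def])
qed

abbreviation S :: "real poly \<Rightarrow> real" where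
  "S \<equiv> sequence_functional (moment \<sigma>)"

lemma integral_poly: "(LINT t|\<sigma>. poly p t) = S p"
  using integrable_power by (simp add: poly_altdef sequence_functional_def moment_def)

text \<open>For \<open>p = a + t * q\<close> the difference quotient at 0 is \<open>q\<close>, so
  the left side is \<open>a * sm\<close> plus the integral of \<open>q\<close>. Through this
  identity the values \<open>P_hat k 0\<close> govern the Hankel determinants of the shifted
  sequence.\<close>

lemma second_kind_at_0:
  "second_kind \<sigma> p 0 + sm * poly p 0 = sequence_functional (case_nat sm (moment \<sigma>)) p"
proof (cases p)
  case (pCons a q)
  have "([:poly p 0:] - p) = [:0, -1:] * q" by (simp add: pCons)
  then have "second_kind \<sigma> p 0 = (LINT t|\<sigma>. poly q t)"
    by (simp only: second_kind_def) (subst nonzero_mult_div_cancel_left, auto)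
  then show ?thesis
    by (simp add: integral_poly pCons sequence_functional_pCons)
qed

definition cauchy :: "real poly \<Rightarrow> complex \<Rightarrow> complex" where
  "cauchy q z = (LINT t|\<sigma>. of_real (poly q t) / (of_real t - z))"

lemma norm_cauchy_kernel_le:
  assumes "Im z > 0"
  shows "norm (of_real (poly q t) / (of_real t - z)) \<le> \<bar>poly q t\<bar> / Im z"
proof -
  have "Im z \<le> norm (of_real t - z)" using abs_Im_le_cmod[of "of_real t - z"] by simp
  then show ?thesis using assms by (simp add: norm_divide frac_le)
qed

lemma integrable_cauchy:
  assumes "z \<in> upper_half_plane"
  shows "integrable \<sigma> (\<lambda>t. of_real (poly q t) / (of_real t - z))"
proof (rule Bochner_Integration.integrable_bound)
  have z: "Im z > 0" using assms by (simp add: upper_half_plane_def)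
  show "integrable \<sigma> (\<lambda>t. \<bar>poly q t\<bar> / Im z)"
    using integrable_poly by (intro integrable_divide integrable_abs)
  have "continuous_on UNIV (\<lambda>t. of_real (poly q t) / (of_real t - z))"
    using z by (intro continuous_intros) (auto simp: complex_eq_iff)
  then show "(\<lambda>t. of_real (poly q t) / (of_real t - z)) \<in> borel_measurable \<sigma>"
    by (intro measurable_borel borel_measurable_continuous_onI)
  show "AE t in \<sigma>. norm (of_real (poly q t) / (of_real t - z)) \<le> norm (\<bar>poly q t\<bar> / Im z)"
    using norm_cauchy_kernel_le[OF z] z by simp
qed

lemma norm_cauchy_le:
  assumes "Im z > 0"
  shows "norm (cauchy q z) \<le> (LINT t|\<sigma>. \<bar>poly q t\<bar>) / Im z"
proof -
  have "norm (cauchy q z) \<le> (LINT t|\<sigma>. norm (of_real (poly q t) / (of_real t - z)))"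
    unfolding cauchy_def by (rule integral_norm_bound)
  also have "\<dots> \<le> (LINT t|\<sigma>. \<bar>poly q t\<bar> / Im z)"
    using norm_cauchy_kernel_le[OF assms] integrable_cauchy[of z q] integrable_poly assms
    by (intro integral_mono integrable_norm integrable_divide integrable_abs)
      (auto simp: upper_half_plane_def)
  also have "\<dots> = (LINT t|\<sigma>. \<bar>poly q t\<bar>) / Im z" by simp
  finally show ?thesis .
qed

lemma cauchy_add:
  assumes "z \<in> upper_half_plane"
  shows "cauchy (p + q) z = cauchy p z + cauchy q z"
  using Bochner_Integration.integral_add[OF integrable_cauchy[OF assms] integrable_cauchy[OF assms], of p q]
  by (simp add: cauchy_def add_divide_distrib)

lemma cauchy_smult: "cauchy (smult a p) z = of_real a * cauchy p z"
  unfolding cauchy_def by (simp flip: integral_mult_right_zero)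

lemma cauchy_0 [simp]: "cauchy 0 z = 0"
  by (simp add: cauchy_def)

text \<open>Integrated form of \<open>t / (t - z) = 1 + z / (t - z)\<close>. It yields both the
  asymptotic expansion and the recurrence of the functions \<open>R k\<close>.\<close>

lemma cauchy_pCons_0:
  assumes "z \<in> upper_half_plane"
  shows "z * cauchy q z = cauchy (pCons 0 q) z - of_real (S q)"
proof -
  have ne: "of_real t - z \<noteq> 0" for t
    using assms by (auto simp: upper_half_plane_def complex_eq_iff)
  have "of_real (S q) = (LINT t|\<sigma>. complex_of_real (poly q t))"
    by (simp add: integral_poly)
  then have "cauchy (pCons 0 q) z - of_real (S q) =
      (LINT t|\<sigma>. of_real (poly (pCons 0 q) t) / (of_real t - z) - of_real (poly q t))"
    unfolding cauchy_def using integrable_cauchy[OF assms, of "pCons 0 q"] integrable_poly[of q]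
    by (simp add: Bochner_Integration.integral_diff)
  also have "\<dots> = (LINT t|\<sigma>. z * (of_real (poly q t) / (of_real t - z)))"
    by (rule Bochner_Integration.integral_cong) (use ne in \<open>auto simp: field_simps\<close>)
  also have "\<dots> = z * cauchy q z"
    unfolding cauchy_def by (rule integral_mult_right_zero)
  finally show ?thesis by simp
qed

lemma cauchy_bigo:
  assumes "\<epsilon> > 0"
  shows "cauchy q \<in> O[sector_infinity \<epsilon>](\<lambda>z. 1 / z)"
proof (cases "\<epsilon> < pi / 2")
  case True
  then have sin: "sin \<epsilon> > 0" using assms by (intro sin_gt_zero) auto
  define C where "C = (LINT t|\<sigma>. \<bar>poly q t\<bar>)"
  have C: "C \<ge> 0" by (simp add: C_def)
  have "eventually (\<lambda>z. norm (cauchy q z) \<le> (C / sin \<epsilon>) * norm (1 / z)) (sector_infinity \<epsilon>)"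
    using eventually_sector_Im_ge[OF assms]
  proof eventually_elim
    case (elim z)
    then have "norm z > 0" by (metis Im_complex_of_real less_irrefl of_real_0 zero_less_norm_iff)
    have "norm (cauchy q z) \<le> C / Im z" using norm_cauchy_le[of z q] elim by (simp add: C_def)
    also have "\<dots> \<le> C / (sin \<epsilon> * norm z)"
      using elim C sin \<open>norm z > 0\<close> by (intro divide_left_mono) auto
    finally show ?case by (simp add: norm_divide)
  qed
  then show ?thesis by (rule bigoI)
next
  case False
  then have "{z. \<epsilon> < Arg z \<and> Arg z < pi - \<epsilon>} = {}" by auto
  then have "sector_infinity \<epsilon> = bot" unfolding sector_infinity_def by (simp only: inf_bot_right flip: bot_eq_principal_empty)
  then show ?thesis by simp
qed

lemma cauchy_eq_sum:
  assumes "z \<in> upper_half_plane"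
  shows "cauchy q z = (\<Sum>i<n. of_real (- S (monom 1 i * q)) / z ^ Suc i) + cauchy (monom 1 n * q) z / z ^ n"
proof (induction n)
  case (Suc n)
  have z: "z \<noteq> 0" using assms by (auto simp: upper_half_plane_def)
  have "monom 1 (Suc n) * q = pCons 0 (monom 1 n * q)" by (simp add: monom_Suc)
  then have "cauchy (monom 1 n * q) z = (cauchy (monom 1 (Suc n) * q) z - of_real (S (monom 1 n * q))) / z"
    using cauchy_pCons_0[OF assms, of "monom 1 n * q"] z by (simp add: field_simps)
  with Suc show ?case by (simp add: diff_divide_distrib)
qed simp

text \<open>The remainder after any number of terms is again a Cauchy transform, that of
  \<open>t ^ n * q\<close>, divided by \<open>z ^ n\<close>; so the single estimate
  \<open>cauchy_bigo\<close> serves all orders.\<close>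

lemma sector_expansion_cauchy:
  "sector_expansion (cauchy q) (Abs_fps (case_nat 0 (\<lambda>i. - S (monom 1 i * q))))"
  unfolding sector_expansion_def
proof (intro allI impI)
  fix n and \<epsilon> :: real assume e: "\<epsilon> > 0"
  let ?f = "Abs_fps (case_nat 0 (\<lambda>i. - S (monom 1 i * q)))"
  show "(\<lambda>z. cauchy q z - (\<Sum>i<n. of_real (?f $ i) / z ^ i)) \<in> O[sector_infinity \<epsilon>](\<lambda>z. 1 / z ^ n)"
  proof (cases n)
    case 0
    then show ?thesis
      using landau_o.big_trans[OF cauchy_bigo[OF e] bigo_sector_inverse_power[of 0 1, simplified]] by simp
  next
    case (Suc m)
    have "(\<lambda>z. cauchy (monom 1 m * q) z * (1 / z ^ m)) \<in> O[sector_infinity \<epsilon>](\<lambda>z. (1 / z) * (1 / z ^ m))"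
      by (intro landau_o.big_mult cauchy_bigo e) simp
    moreover have "eventually (\<lambda>z. cauchy (monom 1 m * q) z * (1 / z ^ m) =
        cauchy q z - (\<Sum>i<n. of_real (?f $ i) / z ^ i)) (sector_infinity \<epsilon>)"
      using eventually_sector_upper_half_plane[OF e]
    proof eventually_elim
      case (elim z)
      show ?case
        using cauchy_eq_sum[OF elim, of q m] unfolding Suc
        by (subst sum.lessThan_Suc_shift) simp
    qed
    ultimately show ?thesis by (simp only: landau_o.big.in_cong) (simp add: Suc)
  qed
qed

end

section \<open>Orthogonality and positive norms\<close>

lemma degree_cancel_leading:
  fixes q r :: "'a :: comm_ring_1 poly"
  assumes "degree r = degree q" "coeff r (degree r) = 1" "q \<noteq> 0"
  shows "q - smult (lead_coeff q) r = 0 \<or> degree (q - smult (lead_coeff q) r) < degree q"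
proof (cases "degree q = 0")
  case True
  then obtain x y where "q = [:x:]" "r = [:y:]" using assms(1) by (metis degree_eq_zeroE)
  then show ?thesis using assms(2) by simp
next
  case False
  have "degree (q - smult (lead_coeff q) r) \<le> degree q"
    using assms(1) by (intro degree_diff_le) (auto intro: degree_smult_le[THEN order_trans])
  moreover have "coeff (q - smult (lead_coeff q) r) (degree q) = 0" using assms(1,2) by simp
  ultimately show ?thesis by (metis le_neq_implies_less leading_coeff_0_iff)
qed

locale orthogonal_polynomials = moment_measure +
  fixes P :: "nat \<Rightarrow> real poly" and b c :: "nat \<Rightarrow> real"
  assumes orthogonal: "monic_orthogonal \<sigma> P"
    and recurrence: "three_term_recurrence P b c"
    and c_pos: "c j > 0"
    and mass_pos: "moment \<sigma> 0 > 0"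
begin

lemma degree_P [simp]: "degree (P j) = j"
  and monic_P [simp]: "coeff (P j) j = 1"
  using orthogonal unfolding monic_orthogonal_def by metis+

lemma P_nonzero [simp]: "P j \<noteq> 0"
  using monic_P[of j] by fastforce

lemma P_0: "P 0 = 1"
proof -
  obtain x where "P 0 = [:x:]" using degree_P[of 0] by (rule degree_eq_zeroE)
  then show ?thesis using monic_P[of 0] by (simp add: one_pCons)
qed

lemma S_orthogonal: "i \<noteq> j \<Longrightarrow> S (P i * P j) = 0"
  using orthogonal by (simp add: monic_orthogonal_def flip: integral_poly)

lemma P_Suc_0: "pCons 0 (P 0) = P 1 + smult (b 0) (P 0)"
  using recurrence unfolding three_term_recurrence_def by (auto dest!: spec[of _ 0])

lemma P_Suc_Suc: "pCons 0 (P (Suc k)) = P (Suc (Suc k)) + smult (b (Suc k)) (P (Suc k)) + smult (c k) (P k)"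
  using recurrence unfolding three_term_recurrence_def by (auto dest!: spec[of _ "Suc k"])

lemmas S_linear = sequence_functional_add sequence_functional_smult

lemma S_mult_P_eq_0: "degree q < k \<Longrightarrow> S (q * P k) = 0"
proof (induction "degree q" arbitrary: q rule: less_induct)
  case less
  show ?case
  proof (cases "q = 0")
    case False
    define r where "r = q - smult (lead_coeff q) (P (degree q))"
    have "r = 0 \<or> degree r < degree q"
      unfolding r_def using False by (intro degree_cancel_leading) auto
    then have "S (r * P k) = 0" using less by auto
    moreover have "q * P k = r * P k + smult (lead_coeff q) (P (degree q) * P k)"
      by (simp add: r_def left_diff_distrib)
    ultimately show ?thesis
      using S_orthogonal[of "degree q" k] less.prems by (simp add: S_linear)
  qed simp
qed

text \<open>This is the squared norm of \<open>P k\<close>, because \<open>P k\<close> is monic and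
  orthogonal to lower degrees. In this form its positivity follows from the recurrence.\<close>

definition h :: "nat \<Rightarrow> real" where
  "h k = S (monom 1 k * P k)"

lemma S_mult_P_degree: 
  assumes "degree q = k"
  shows "S (q * P k) = lead_coeff q * h k"
proof (cases "q = 0")
  case False
  define r where "r = q - smult (lead_coeff q) (monom 1 k)"
  have "r = 0 \<or> degree r < degree q"
    unfolding r_def using False assms by (intro degree_cancel_leading) (auto simp: degree_monom_eq)
  then have "S (r * P k) = 0" using S_mult_P_eq_0[of r k] assms by auto
  moreover have "q * P k = r * P k + smult (lead_coeff q) (monom 1 k * P k)"
    by (simp add: r_def left_diff_distrib)
  ultimately show ?thesis by (simp add: S_linear h_def)
qed simp

lemma h_0: "h 0 = moment \<sigma> 0"
  by (simp add: h_def P_0 sequence_functional_def)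

lemma h_Suc: "h (Suc k) = c k * h k"
proof -
  have "h (Suc k) = S (monom 1 k * pCons 0 (P (Suc k)))"
    by (simp add: h_def monom_Suc)
  also have "\<dots> = S (monom 1 k * P (Suc (Suc k))) + b (Suc k) * S (monom 1 k * P (Suc k)) + c k * h k"
    by (simp add: P_Suc_Suc distrib_left S_linear h_def)
  also have "\<dots> = c k * h k"
    by (simp add: S_mult_P_eq_0 degree_monom_eq)
  finally show ?thesis .
qed

lemma h_pos: "h k > 0"
  by (induction k) (simp_all add: h_0 mass_pos h_Suc c_pos)

text \<open>For nonzero \<open>q\<close> of degree \<open>d\<close>, testing against
  \<open>P d\<close> gives \<open>lead_coeff q * h d\<close>, which is not 0, while
  \<open>P d\<close> is a combination of powers below \<open>m\<close>.\<close>

lemma eq_0_if_orthogonal_to_powers: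
  assumes "degree q < m" "\<And>i. i < m \<Longrightarrow> S (monom 1 i * q) = 0"
  shows "q = 0"
proof (rule ccontr)
  assume "q \<noteq> 0"
  define d where "d = degree q"
  have "P d * q = (\<Sum>i\<le>d. smult (coeff (P d) i) (monom 1 i * q))"
    using arg_cong[OF poly_as_sum_of_monoms[of "P d"], of "\<lambda>p. p * q"]
    by (simp add: sum_distrib_right smult_monom flip: mult_smult_left)
  also have "S \<dots> = (\<Sum>i\<le>d. coeff (P d) i * S (monom 1 i * q))"
    by (simp add: sequence_functional_sum S_linear)
  also have "\<dots> = 0" using assms by (intro sum.neutral) (auto simp: d_def)
  finally have "lead_coeff q * h d = 0"
    using S_mult_P_degree[of q d] by (simp add: d_def mult.commute)
  then show False using h_pos[of d] \<open>q \<noteq> 0\<close> by simp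
qed

end

section \<open>The shifted moment sequence and its normal indices\<close>

locale shifted_moments = orthogonal_polynomials +
  fixes sm :: real
begin

abbreviation T :: "real poly \<Rightarrow> real" where
  "T \<equiv> sequence_functional (case_nat sm (moment \<sigma>))"

lemma T_pCons_0: "T (pCons 0 q) = S q"
  by (simp add: sequence_functional_pCons)

lemma P_hat_at_0: "P_hat \<sigma> P sm k 0 = T (P k)"
  by (simp add: P_hat_def second_kind_at_0)

lemma T_P_0: "T (P 0) = sm"
  by (simp add: P_0 sequence_functional_def)

lemma S_P: "S (P k) = (if k = 0 then moment \<sigma> 0 else 0)"
  using S_mult_P_eq_0[of 1 k] by (auto simp: P_0 sequence_functional_def)

lemma T_P_Suc_0: "T (P 1) + b 0 * sm = moment \<sigma> 0"
proof -
  have "T (pCons 0 (P 0)) = T (P 1 + smult (b 0) (P 0))" by (simp only: P_Suc_0)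
  then show ?thesis by (simp add: T_pCons_0 S_P S_linear T_P_0)
qed

lemma T_P_Suc_Suc: "T (P (Suc (Suc k))) + b (Suc k) * T (P (Suc k)) + c k * T (P k) = 0"
proof -
  have "T (pCons 0 (P (Suc k))) = T (P (Suc (Suc k)) + smult (b (Suc k)) (P (Suc k)) + smult (c k) (P k))"
    by (simp only: P_Suc_Suc)
  then show ?thesis by (simp add: T_pCons_0 S_P S_linear)
qed

text \<open>Since \<open>c k\<close> is positive, two consecutive zeros would propagate down the
  recurrence to \<open>T (P 0) = T (P 1) = 0\<close>, against \<open>T_P_Suc_0\<close> and the
  positive mass. This is why no block is larger than 2.\<close>

lemma not_both_T_P_0: "T (P k) \<noteq> 0 \<or> T (P (Suc k)) \<noteq> 0"
proof (induction k)
  case 0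
  then show ?case using T_P_Suc_0 mass_pos by (auto simp: T_P_0)
next
  case (Suc k)
  then show ?case using T_P_Suc_Suc[of k] c_pos[of k] by auto
qed

text \<open>After its first row, the Hankel matrix of the shifted sequence imposes moment conditions
  of \<open>\<sigma>\<close> itself. In degree at most \<open>m\<close> these force \<open>q\<close>
  to be a multiple of \<open>P m\<close>, so the first row decides by
  \<open>T (P m)\<close>.\<close>

lemma hankel_det_Suc_eq_0_iff: "hankel_det (case_nat sm (moment \<sigma>)) (Suc m) = 0 \<longleftrightarrow> T (P m) = 0"
proof -
  have shift: "T (monom 1 (Suc i) * q) = S (monom 1 i * q)" for i q
    by (simp add: monom_Suc T_pCons_0)
  have rows: "(\<forall>i<Suc m. T (monom 1 i * q) = 0) \<longleftrightarrow> T q = 0 \<and> (\<forall>i<m. S (monom 1 i * q) = 0)" for q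
    by (simp add: All_less_Suc2 shift)
  show ?thesis
    unfolding hankel_det_eq_0_iff rows
  proof
    assume "T (P m) = 0"
    then show "\<exists>q. q \<noteq> 0 \<and> degree q < Suc m \<and> T q = 0 \<and> (\<forall>i<m. S (monom 1 i * q) = 0)"
      by (intro exI[of _ "P m"]) (simp add: S_mult_P_eq_0 degree_monom_eq)
  next
    assume "\<exists>q. q \<noteq> 0 \<and> degree q < Suc m \<and> T q = 0 \<and> (\<forall>i<m. S (monom 1 i * q) = 0)"
    then obtain q where q: "q \<noteq> 0" "degree q < Suc m" "T q = 0" "\<And>i. i < m \<Longrightarrow> S (monom 1 i * q) = 0"
      by blast
    have deg: "degree q = m"
      using eq_0_if_orthogonal_to_powers[of q m] q by force
    define r where "r = q - smult (lead_coeff q) (P m)"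
    have "S (monom 1 i * r) = 0" if "i < m" for i
      using q(4)[OF that] that
      by (simp add: r_def right_diff_distrib sequence_functional_diff S_linear S_mult_P_eq_0 degree_monom_eq)
    moreover have "r = 0 \<or> degree r < m"
      unfolding r_def deg[symmetric] using q(1) by (intro degree_cancel_leading) auto
    ultimately have "r = 0" using eq_0_if_orthogonal_to_powers[of r m] by blast
    then have "q = smult (lead_coeff q) (P m)" by (simp add: r_def)
    then have "T q = lead_coeff q * T (P m)"
      using sequence_functional_smult[of _ "lead_coeff q" "P m"] by metis
    then show "T (P m) = 0" using q(1,3) by simp
  qed
qed

definition n :: "nat \<Rightarrow> nat" where
  "n = normal_index (case_nat sm (moment \<sigma>))"

definition normal_indices :: "nat set" where
  "normal_indices = insert 0 {k. 1 \<le> k \<and> T (P (k - 1)) \<noteq> 0}"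

lemma n_eq_enumerate: "n = enumerate normal_indices"
proof -
  have "1 \<le> k \<and> hankel_det (case_nat sm (moment \<sigma>)) k \<noteq> 0 \<longleftrightarrow> 1 \<le> k \<and> T (P (k - 1)) \<noteq> 0" for k
    using hankel_det_Suc_eq_0_iff[of "k - 1"] by (cases k) auto
  then show ?thesis by (simp add: n_def normal_index_def normal_indices_def)
qed

lemma Suc_in_normal_indices: "Suc k \<in> normal_indices \<longleftrightarrow> T (P k) \<noteq> 0"
  by (simp add: normal_indices_def)

lemma infinite_normal_indices: "infinite normal_indices"
  unfolding infinite_nat_iff_unbounded
proof
  fix m
  show "\<exists>k>m. k \<in> normal_indices"
    using not_both_T_P_0[of m] Suc_in_normal_indices[of m] Suc_in_normal_indices[of "Suc m"]
    by (meson lessI less_SucI)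
qed

lemma n_Suc: "n (Suc j) = (if T (P (n j)) \<noteq> 0 then n j + 1 else n j + 2)"
proof -
  have "n (Suc j) = (LEAST s. s \<in> normal_indices \<and> n j < s)"
    unfolding n_eq_enumerate using infinite_normal_indices by (rule enumerate_Suc'')
  also have "\<dots> = (if T (P (n j)) \<noteq> 0 then n j + 1 else n j + 2)"
  proof (cases "T (P (n j)) = 0")
    case True
    show ?thesis
    proof (rule trans[OF Least_equality[where x = "n j + 2"]])
      show "n j + 2 \<in> normal_indices \<and> n j < n j + 2"
        using True not_both_T_P_0[of "n j"] Suc_in_normal_indices[of "Suc (n j)"] by simp
      fix s assume s: "s \<in> normal_indices \<and> n j < s"
      then have "s \<noteq> Suc (n j)" using True Suc_in_normal_indices[of "n j"] by auto
      with s show "n j + 2 \<le> s" by simp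
    qed (use True in simp)
  next
    case False
    then show ?thesis
      using Suc_in_normal_indices[of "n j"] by (subst Least_equality[where x = "n j + 1"]) auto
  qed
  finally show ?thesis .
qed

lemma n_0: "n 0 = 0"
  unfolding n_eq_enumerate enumerate_0 by (rule Least_equality) (auto simp: normal_indices_def)

sublocale block_partition n
  using n_0 n_Suc by unfold_locales auto

lemma block_size_1_iff: "block_size n j = 1 \<longleftrightarrow> T (P (n j)) \<noteq> 0"
  by (simp add: block_size_def n_Suc)

lemma T_P_last_nonzero: "T (P (n (Suc j) - 1)) \<noteq> 0"
  using n_Suc[of j] not_both_T_P_0[of "n j"] by (auto split: if_splits)

end

section \<open>Continued fractions from three-term recurrences\<close>

lemma sector_expansion_leading_eventually_nonzero:
  assumes "sector_expansion G f" "\<And>i. i < k \<Longrightarrow> f $ i = 0" "f $ k \<noteq> 0" "\<epsilon> > 0"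
  shows "eventually (\<lambda>z. G z \<noteq> 0) (sector_infinity \<epsilon>)"
proof -
  have "sector_expansion (\<lambda>z. z ^ k * G z) (fps_shift k f)"
    using assms(1,2) by (rule sector_expansion_mult_power)
  then have "eventually (\<lambda>z. z ^ k * G z \<noteq> 0) (sector_infinity \<epsilon>)"
    using assms(3,4) by (intro sector_expansion_eventually_nonzero[where f = "fps_shift k f"]) auto
  then show ?thesis by eventually_elim auto
qed

lemma sector_expansion_quotient:
  assumes G: "sector_expansion G f" "\<And>i. i < m + k \<Longrightarrow> f $ i = 0"
    and H: "sector_expansion H g" "\<And>i. i < m \<Longrightarrow> g $ i = 0" "g $ m \<noteq> 0"
  obtains r where "sector_expansion (\<lambda>z. G z / H z) r" "\<And>i. i < k \<Longrightarrow> r $ i = 0"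
    "r $ k = f $ (m + k) / g $ m"
proof
  define r where "r = fps_X ^ k * (fps_shift (m + k) f * inverse (fps_shift m g))"
  have "sector_expansion (\<lambda>z. (z ^ (m + k) * G z) * inverse (z ^ m * H z) / z ^ k) r"
    unfolding r_def using H(3)
    by (intro sector_expansion_divide_power sector_expansion_mult sector_expansion_inverse
        sector_expansion_mult_power G H) auto
  moreover have "(z ^ (m + k) * G z) * inverse (z ^ m * H z) / z ^ k = G z / H z"
    if "z \<in> upper_half_plane" for z
  proof -
    have "z \<noteq> 0" using that by (auto simp: upper_half_plane_def)
    \<comment> \<open>At a zero of \<open>H\<close> both sides are 0 by the convention for division
      by 0.\<close>
    then show ?thesis by (cases "H z = 0") (simp_all add: field_simps power_add)
  qed
  ultimately show "sector_expansion (\<lambda>z. G z / H z) r"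
    by (rule sector_expansion_cong)
  show "r $ i = 0" if "i < k" for i
    using that by (simp add: r_def fps_X_power_mult_nth)
  show "r $ k = f $ (m + k) / g $ m"
    by (simp add: r_def fps_X_power_mult_nth divide_inverse add.commute)
qed

lemma sector_expansion_first_asymptotic_coeff:
  assumes "sector_expansion G f" "\<And>i. i < k \<Longrightarrow> f $ i = 0" "f $ k \<noteq> 0" "k > 0"
  shows "first_asymptotic_coeff G (- f $ k)"
  unfolding first_asymptotic_coeff_def
proof (intro exI conjI)
  show "has_asymptotics G (\<lambda>j. - f $ Suc j)"
    using assms by (intro sector_expansion_imp_has_asymptotics) auto
  show "- f $ Suc (k - 1) \<noteq> 0" using assms(3,4) by simp
  have "(LEAST i. - f $ Suc i \<noteq> 0) = k - 1"
  proof (rule Least_equality)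
    show "- f $ Suc (k - 1) \<noteq> 0" using assms(3,4) by simp
    show "k - 1 \<le> i" if "- f $ Suc i \<noteq> 0" for i
      using that assms(2)[of "Suc i"] by (cases "Suc i < k") auto
  qed
  then show "first_nonzero (\<lambda>j. - f $ Suc j) = - f $ k"
    using assms(4) by (simp add: first_nonzero_def)
qed

text \<open>The recurrence divided by \<open>Y (Suc j)\<close> becomes the continued fraction,
  because \<open>\<epsilon> j * d j = \<bar>d j\<bar> * \<epsilon> (Suc j)\<close>. The common
  leading coefficient -1 of the \<open>Y j\<close> makes each function normalized, with first
  asymptotic coefficient \<open>\<epsilon> j\<close>.\<close>

proposition continued_fraction_expansion_of_recurrence:
  fixes Y :: "nat \<Rightarrow> complex \<Rightarrow> complex" and y :: "nat \<Rightarrow> real fps"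
    and p :: "nat \<Rightarrow> real poly" and d \<epsilon> :: "nat \<Rightarrow> real" and n :: "nat \<Rightarrow> nat"
  assumes holo: "\<And>j. Y j holomorphic_on upper_half_plane"
    and expansion: "\<And>j. sector_expansion (Y j) (y j)"
    and vanish: "\<And>i j. i < n j \<Longrightarrow> y j $ i = 0"
    and leading: "\<And>j. y j $ n j = - 1"
    and mono: "\<And>j. n j < n (Suc j)"
    and d: "\<And>j. d j \<noteq> 0"
    and monic: "\<And>j. lead_coeff (p j) = 1"
    and recurrence: "\<And>j z. z \<in> upper_half_plane \<Longrightarrow>
      of_real (d j) * Y (Suc (Suc j)) z = poly (map_poly of_real (p j)) z * Y (Suc j) z - Y j z"
    and sign: "\<bar>\<epsilon> 0\<bar> = 1" "\<And>j. \<epsilon> (Suc j) = \<epsilon> j * sgn (d j)"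
  shows "continued_fraction_expansion (\<lambda>j z. - of_real (\<epsilon> j) * (Y (Suc j) z / Y j z)) \<epsilon> p (\<lambda>j. sqrt \<bar>d j\<bar>)"
    (is "continued_fraction_expansion ?\<Phi> _ _ _")
proof -
  have abs_sign: "\<bar>\<epsilon> j\<bar> = 1" for j
    by (induction j) (simp_all add: sign abs_mult abs_sgn_eq d)
  have sign_sq: "\<epsilon> j * \<epsilon> j = 1" for j
    using abs_sign[of j] by (metis abs_mult_self_eq mult_1)
  have "\<exists>r. sector_expansion (?\<Phi> j) r \<and> (\<forall>i<n (Suc j) - n j. r $ i = 0) \<and> r $ (n (Suc j) - n j) = - \<epsilon> j" for j
  proof -
    have nj: "n j + (n (Suc j) - n j) = n (Suc j)" using mono[of j] by simp
    obtain r where r: "sector_expansion (\<lambda>z. Y (Suc j) z / Y j z) r"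
      "\<And>i. i < n (Suc j) - n j \<Longrightarrow> r $ i = 0"
      "r $ (n (Suc j) - n j) = y (Suc j) $ (n j + (n (Suc j) - n j)) / y j $ n j"
      by (rule sector_expansion_quotient[OF expansion[of "Suc j"] _ expansion[of j] vanish[of _ j],
            where k = "n (Suc j) - n j"])
        (use nj leading vanish in auto)
    have "sector_expansion (\<lambda>z. of_real (- \<epsilon> j) * (Y (Suc j) z / Y j z)) (fps_const (- \<epsilon> j) * r)"
      by (rule sector_expansion_cmult[OF r(1)])
    then show ?thesis using r(2,3) nj leading by (intro exI[of _ "fps_const (- \<epsilon> j) * r"]) auto
  qed
  then obtain r where r: "\<And>j. sector_expansion (?\<Phi> j) (r j)"
    "\<And>i j. i < n (Suc j) - n j \<Longrightarrow> r j $ i = 0" "\<And>j. r j $ (n (Suc j) - n j) = - \<epsilon> j"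
    by metis
  have eps_nz: "\<epsilon> j \<noteq> 0" for j using abs_sign[of j] by auto
  have step: "- 1 / ?\<Phi> j z = of_real (\<epsilon> j) * poly (map_poly of_real (p j)) z
      + of_real ((sqrt \<bar>d j\<bar>)\<^sup>2) * ?\<Phi> (j + 1) z"
    if z: "z \<in> upper_half_plane" and nz: "?\<Phi> j z \<noteq> 0" for j z
  proof -
    \<comment> \<open>The denominator is nonzero too, since a quotient by 0 would be 0.\<close>
    have Y: "Y j z \<noteq> 0" "Y (Suc j) z \<noteq> 0" using nz by auto
    have "\<epsilon> j * (\<epsilon> j * sgn (d j)) * \<bar>d j\<bar> = d j"
      using sign_sq[of j] by (metis mult.assoc mult_1 sgn_mult_abs)
    then have "\<bar>d j\<bar> * \<epsilon> (Suc j) = \<epsilon> j * d j"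
      using sign_sq[of j] by (simp add: sign(2) mult_ac) (metis mult.assoc mult_1 sgn_mult_abs)
    then have *: "of_real \<bar>d j\<bar> * complex_of_real (\<epsilon> (Suc j)) = of_real (\<epsilon> j) * of_real (d j)"
      by (simp flip: of_real_mult)
    have "of_real ((sqrt \<bar>d j\<bar>)\<^sup>2) * ?\<Phi> (j + 1) z =
        - (of_real \<bar>d j\<bar> * of_real (\<epsilon> (Suc j))) * Y (Suc (Suc j)) z / Y (Suc j) z"
      by simp
    also have "\<dots> = - of_real (\<epsilon> j) * (of_real (d j) * Y (Suc (Suc j)) z) / Y (Suc j) z"
      unfolding * by simp
    also have "\<dots> = - of_real (\<epsilon> j) * poly (map_poly of_real (p j)) z + of_real (\<epsilon> j) * (Y j z / Y (Suc j) z)"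
      unfolding recurrence[OF z] using Y by (simp add: field_simps)
    also have "of_real (\<epsilon> j) * (Y j z / Y (Suc j) z) = - 1 / ?\<Phi> j z"
      using Y eps_nz[of j] sign_sq[of j] by (simp add: field_simps flip: of_real_mult)
    finally show ?thesis by simp
  qed
  show ?thesis
    unfolding continued_fraction_expansion_def
  proof (intro allI conjI impI ballI)
    fix j
    show "?\<Phi> j meromorphic_on upper_half_plane"
      using holo open_upper_half_plane
      by (intro meromorphic_intros analytic_on_imp_meromorphic_on) (simp_all add: analytic_on_open)
    show "\<bar>\<epsilon> j\<bar> = 1" by (rule abs_sign)
    show "first_asymptotic_coeff (?\<Phi> j) (\<epsilon> j)"
      using sector_expansion_first_asymptotic_coeff[OF r(1)[of j], of "n (Suc j) - n j"] r(2)[of _ j] r(3)[of j] eps_nz[of j] mono[of j]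
      by simp
    show "lead_coeff (p j) = 1" by (rule monic)
    show "sqrt \<bar>d j\<bar> > 0" using d[of j] by simp
    show "- 1 / ?\<Phi> j z = of_real (\<epsilon> j) * poly (map_poly of_real (p j)) z
        + of_real ((sqrt \<bar>d j\<bar>)\<^sup>2) * ?\<Phi> (j + 1) z"
      if "z \<in> upper_half_plane" "?\<Phi> j z \<noteq> 0" for z
      using that by (rule step)
    show "(\<lambda>z. - 1 / ?\<Phi> j z - of_real (\<epsilon> j) * poly (map_poly of_real (p j)) z) \<in> o[sector_infinity \<delta>](\<lambda>_. 1)"
      if \<delta>: "\<delta> > 0" for \<delta>
    proof -
      \<comment> \<open>Wherever \<open>?\<Phi> j\<close> is nonzero, hence eventually in the
        sector, the difference is a constant times \<open>?\<Phi> (j + 1)\<close>, which tends to 0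
        as its expansion has no constant term.\<close>
      have "r (j + 1) $ 0 = 0" using r(2)[of 0 "j + 1"] mono[of "j + 1"] by simp
      then have "(?\<Phi> (j + 1) \<longlongrightarrow> 0) (sector_infinity \<delta>)"
        using sector_expansion_tendsto[OF r(1)[of "j + 1"] \<delta>] by simp
      then have "((\<lambda>z. of_real ((sqrt \<bar>d j\<bar>)\<^sup>2) * ?\<Phi> (j + 1) z) \<longlongrightarrow> 0) (sector_infinity \<delta>)"
        by (rule tendsto_mult_right_zero)
      then have "(\<lambda>z. of_real ((sqrt \<bar>d j\<bar>)\<^sup>2) * ?\<Phi> (j + 1) z) \<in> o[sector_infinity \<delta>](\<lambda>_. 1)"
        by (intro smalloI_tendsto) simp_all
      moreover have "eventually (\<lambda>z. ?\<Phi> j z \<noteq> 0) (sector_infinity \<delta>)"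
      proof (rule sector_expansion_leading_eventually_nonzero[OF r(1)[of j] _ _ \<delta>])
        show "r j $ i = 0" if "i < n (Suc j) - n j" for i using r(2)[OF that] .
        show "r j $ (n (Suc j) - n j) \<noteq> 0" using r(3)[of j] eps_nz[of j] by simp
      qed
      then have "eventually (\<lambda>z. of_real ((sqrt \<bar>d j\<bar>)\<^sup>2) * ?\<Phi> (j + 1) z =
          - 1 / ?\<Phi> j z - of_real (\<epsilon> j) * poly (map_poly of_real (p j)) z) (sector_infinity \<delta>)"
        using eventually_sector_upper_half_plane[OF \<delta>]
      proof eventually_elim
        case (elim z)
        show ?case using step[OF elim(2,1)] by (simp only: add_diff_cancel_left')
      qed
      ultimately show ?thesis by (simp only: landau_o.small.in_cong)
    qed
  qed
qed

section \<open>The Darboux transform\<close>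

locale block_UL = shifted_moments +
  fixes F :: "complex \<Rightarrow> complex" and u e l :: "nat \<Rightarrow> real"
  assumes F_holomorphic: "F holomorphic_on upper_half_plane"
    and F_eq: "z \<in> upper_half_plane \<Longrightarrow> F z = cauchy 1 z"
    and J_eq: "jacobi_matrix b c = upper_factor n u \<star> lower_factor n e l"
    and l_eq: "l j = - T (P (n (Suc j) - 1)) / T (P (n j - 1))"
begin

abbreviation R :: "nat \<Rightarrow> complex \<Rightarrow> complex" where
  "R k \<equiv> cauchy (P k)"

lemma R_Suc_0:
  assumes "z \<in> upper_half_plane"
  shows "z * R 0 z = R 1 z + of_real (b 0) * R 0 z - of_real (moment \<sigma> 0)"
  using cauchy_pCons_0[OF assms, of "P 0"] by (simp add: P_Suc_0 cauchy_add assms cauchy_smult S_P)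

lemma R_Suc_Suc:
  assumes "z \<in> upper_half_plane"
  shows "z * R (Suc k) z = R (Suc (Suc k)) z + of_real (b (Suc k)) * R (Suc k) z + of_real (c k) * R k z"
  using cauchy_pCons_0[OF assms, of "P (Suc k)"]
  by (simp add: P_Suc_Suc cauchy_add assms cauchy_smult S_P)

text \<open>The recurrence carries holomorphy over from \<open>R 0\<close>, which is
  \<open>F\<close> on the half plane; differentiation under the integral sign is avoided.\<close>

lemma R_holomorphic: "R k holomorphic_on upper_half_plane"
proof (induction k rule: less_induct)
  case (less k)
  consider "k = 0" | "k = 1" | m where "k = Suc (Suc m)" by (metis One_nat_def not0_implies_Suc)
  then show ?case
  proof cases
    case 1
    show ?thesis
      using F_holomorphic by (rule holomorphic_transform) (simp add: 1 F_eq P_0)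
  next
    case 2
    have "(\<lambda>z. z * R 0 z - of_real (b 0) * R 0 z + of_real (moment \<sigma> 0)) holomorphic_on upper_half_plane"
      using less[of 0] 2 by (intro holomorphic_intros) simp_all
    then show ?thesis by (rule holomorphic_transform) (simp add: 2 R_Suc_0)
  next
    case (3 m)
    have "(\<lambda>z. z * R (Suc m) z - of_real (b (Suc m)) * R (Suc m) z - of_real (c m) * R m z)
        holomorphic_on upper_half_plane"
      using less[of m] less[of "Suc m"] 3 by (intro holomorphic_intros) simp_all
    then show ?thesis by (rule holomorphic_transform) (simp add: 3 R_Suc_Suc)
  qed
qed

lemma l_nonzero: "j > 0 \<Longrightarrow> l j \<noteq> 0"
  using T_P_last_nonzero[of j] T_P_last_nonzero[of "j - 1"] by (simp add: l_eq)

lemmas single = jacobi_UL_single_block[OF J_eq]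
lemmas double = jacobi_UL_double_block[OF J_eq]

lemma sm_eq_0: "block_size n 0 = 2 \<Longrightarrow> sm = 0"
  using block_size_1_iff[of 0] by (simp add: n_0 T_P_0)

text \<open>The first component of \<open>U (L P_hat) = s\<^sub>0 e\<^sub>0\<close>: the entry of
  \<open>L P_hat\<close> in the first block is \<open>sm\<close>, and the following entry is 0 for
  either size of the next block.\<close>

lemma u_0_sm:
  assumes "block_size n 0 = 1"
  shows "u 0 * sm = moment \<sigma> 0"
proof -
  have n1: "n (Suc 0) = 1" using assms n_0 by (simp add: block_size_def)
  have sm: "sm \<noteq> 0" using assms block_size_1_iff[of 0] by (simp add: n_0 T_P_0)
  have b0: "b 0 = u 0 + (if block_size n 1 = 1 then l 1 else 0)"
    using single(1)[OF assms] by (simp add: n_0)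
  show ?thesis
  proof (cases rule: block_size_cases[of 1])
    case 1
    have "l 1 = - T (P 1) / sm" using l_eq[of 1] 1 n1 by (simp add: T_P_0)
    then have "T (P 1) = - l 1 * sm" using sm by (simp add: field_simps)
    then show ?thesis using T_P_Suc_0 b0 1 by (simp add: algebra_simps)
  next
    case 2
    then have "T (P 1) = 0" using block_size_1_iff[of 1] n1 by simp
    then show ?thesis using T_P_Suc_0 b0 2 by simp
  qed
qed

lemma u_nonzero: "u j \<noteq> 0"
proof (cases rule: block_size_cases[of j])
  case 1
  show ?thesis
  proof (cases "j = 0")
    case True
    then show ?thesis using u_0_sm 1 mass_pos by auto
  next
    case False
    then show ?thesis using single(2)[of j] 1 c_pos[of "n j - 1"] by auto
  qed
next
  case 2
  then show ?thesis using double(2)[of j] c_pos[of "n j"] by auto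
qed

definition q :: "nat \<Rightarrow> real poly" where
  "q j = P (n j) + (if block_size n j = 1 \<and> j > 0 then smult (l j) (P (n j - 1)) else 0)"

text \<open>The first entries of the blocks of \<open>(L (R - P_hat 0)) / z\<close>. Here \<open>l\<close> makes the entries of
  \<open>L (P_hat 0)\<close> that occur for \<open>j > 0\<close> vanish.\<close>

definition V :: "nat \<Rightarrow> complex \<Rightarrow> complex" where
  "V j z = (if j = 0 then (F z - of_real sm) / z else cauchy (q j) z / z)"

lemma V_single:
  assumes "z \<in> upper_half_plane" "block_size n j = 1" "j > 0"
  shows "z * V j z = R (n j) z + of_real (l j) * R (n j - 1) z"
  using assms upper_half_plane_nonzero[OF assms(1)]
  by (simp add: V_def q_def cauchy_add cauchy_smult)

lemma V_double:
  assumes "z \<in> upper_half_plane" "block_size n j = 2"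
  shows "z * V j z = R (n j) z"
  using assms upper_half_plane_nonzero[OF assms(1)] sm_eq_0
  by (auto simp: V_def q_def F_eq n_0 P_0)

lemma V_0:
  assumes "z \<in> upper_half_plane"
  shows "z * V 0 z = R 0 z - of_real sm"
  using assms upper_half_plane_nonzero[OF assms(1)] by (simp add: V_def F_eq P_0)

text \<open>This is the last row of block \<open>j\<close> in \<open>U W = R\<close>. Multiplied by
  \<open>z\<close>, it is the recurrence of \<open>R\<close> with \<open>b\<close> and
  \<open>c\<close> expressed through the entries of \<open>U\<close> and \<open>L\<close>.\<close>

lemma u_V_plus_V:
  assumes z: "z \<in> upper_half_plane"
  shows "of_real (u j) * V j z + V (Suc j) z = R (n (Suc j) - 1) z"
proof -
  have "of_real (u j) * (z * V j z) + z * V (Suc j) z = z * R (n (Suc j) - 1) z"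
  proof (cases rule: block_size_cases[of j])
    case 1
    \<comment> \<open>The contribution of \<open>l (Suc j)\<close> to row \<open>n (Suc j)\<close>
      of \<open>L\<close>. The same term occurs in \<open>b (n j)\<close>, so both sizes of the next
      block are treated at once.\<close>
    define t where "t = (if block_size n (Suc j) = 1 then l (Suc j) else 0)"
    have next_V: "z * V (Suc j) z = R (Suc (n j)) z + of_real t * R (n j) z"
      using V_single[OF z, of "Suc j"] V_double[OF z, of "Suc j"] 1
      by (cases rule: block_size_cases[of "Suc j"]) (simp_all add: t_def)
    have b: "b (n j) = u j + t" using single(1)[OF 1(1)] by (simp add: t_def)
    show ?thesis
    proof (cases "j = 0")
      case True
      have "complex_of_real (moment \<sigma> 0) = of_real (u 0) * of_real sm"
        using u_0_sm 1 True by (simp flip: of_real_mult)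
      then have "of_real (u 0) * (R 0 z - of_real sm) + (R 1 z + of_real t * R 0 z) = z * R 0 z"
        using R_Suc_0[OF z] b True by (simp add: n_0 algebra_simps)
      then show ?thesis using V_0[OF z] next_V True 1 by (simp add: n_0)
    next
      case False
      then obtain m where m: "n j = Suc m" using start_pos[of j] gr0_conv_Suc by blast
      have "c m = u j * l j" using single(2)[OF 1(1)] False m by simp
      then show ?thesis
        using R_Suc_Suc[OF z, of m] V_single[OF z 1(1)] next_V b False 1 m by (simp add: algebra_simps)
    qed
  next
    case 2
    have next_V: "z * V (Suc j) z = R (Suc (Suc (n j))) z + of_real (b (Suc (n j))) * R (Suc (n j)) z"
      using V_single[OF z, of "Suc j"] V_double[OF z, of "Suc j"] 2 double(3)[OF 2(1)]
      by (cases rule: block_size_cases[of "Suc j"]) simp_all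
    show ?thesis
      using R_Suc_Suc[OF z, of "n j"] V_double[OF z 2(1)] next_V double(2)[OF 2(1)] 2
      by (simp add: algebra_simps)
  qed
  then have "z * (of_real (u j) * V j z + V (Suc j) z) = z * R (n (Suc j) - 1) z"
    by (simp add: algebra_simps)
  then show ?thesis using upper_half_plane_nonzero[OF z] by simp
qed

abbreviation p :: "nat \<Rightarrow> real poly" where
  "p \<equiv> jacobi_polynomial u e l"

text \<open>Minus the leading coefficient of \<open>V j\<close>. In
  \<open>u j * V j + V (Suc j) = R (n (Suc j) - 1)\<close> the second summand is of lower order and
  the right side starts with \<open>- h (n (Suc j) - 1)\<close>, whence the quotient.\<close>

definition g :: "nat \<Rightarrow> real" where
  "g j = h (n (Suc j) - 1) / u j"

lemma g_nonzero: "g j \<noteq> 0"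
  using h_pos[of "n (Suc j) - 1"] u_nonzero[of j] by (simp add: g_def)

lemma g_single:
  assumes "block_size n j = 1" "j > 0"
  shows "g j = l j * h (n j - 1)"
proof -
  obtain m where m: "n j = Suc m" using start_pos[of j] assms(2) gr0_conv_Suc by blast
  have "n (Suc j) - 1 = Suc m" using assms(1) m by (cases rule: block_size_cases[of j]) auto
  then show ?thesis
    using single(2)[OF assms] m u_nonzero[of j] by (simp add: g_def h_Suc field_simps)
qed

lemma g_double:
  assumes "block_size n j = 2"
  shows "g j = h (n j)"
proof -
  have "n (Suc j) - 1 = Suc (n j)" using assms by (cases rule: block_size_cases[of j]) auto
  then show ?thesis
    using double(2)[OF assms] u_nonzero[of j] by (simp add: g_def h_Suc field_simps)
qed

lemma g_0: "g 0 = (if block_size n 0 = 1 then sm else moment \<sigma> 0)"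
proof (cases rule: block_size_cases[of 0])
  case 1
  then show ?thesis using u_0_sm u_nonzero[of 0] by (simp add: g_def n_0 h_0 field_simps)
next
  case 2
  then show ?thesis using g_double[of 0] by (simp add: n_0 h_0)
qed

text \<open>The factor \<open>l (Suc j) * u j\<close> is the subdiagonal entry of
  \<open>L U\<close>, so the signs of \<open>g\<close> obey the sign rule of the continued
  fraction.\<close>

lemma g_Suc: "g (Suc j) = l (Suc j) * u j * g j"
proof -
  have "g (Suc j) = l (Suc j) * h (n (Suc j) - 1)"
  proof (cases rule: block_size_cases[of "Suc j"])
    case 1
    then show ?thesis using g_single by simp
  next
    case 2
    obtain m where m: "n (Suc j) = Suc m" using start_pos[of "Suc j"] gr0_conv_Suc by blast
    show ?thesis using g_double[OF 2(1)] double(4)[OF 2(1)] m by (simp add: h_Suc)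
  qed
  then show ?thesis using u_nonzero[of j] by (simp add: g_def)
qed

text \<open>The last row of block \<open>Suc j\<close> in \<open>L U W = z W\<close>, obtained by
  eliminating \<open>R\<close> through \<open>u_V_plus_V\<close> at \<open>j\<close> and
  \<open>Suc j\<close>. In a block of size 2 the second entry of \<open>W\<close> is
  \<open>z * V (Suc j) z\<close>, which accounts for the quadratic polynomial.\<close>

lemma V_recurrence_Suc:
  assumes z: "z \<in> upper_half_plane"
  shows "V (Suc (Suc j)) z = poly (map_poly of_real (p (Suc j))) z * V (Suc j) z
           - of_real (l (Suc j) * u j) * V j z"
proof (cases rule: block_size_cases[of "Suc j"])
  case 1
  have "z * V (Suc j) z = (of_real (u (Suc j)) * V (Suc j) z + V (Suc (Suc j)) z)
      + of_real (l (Suc j)) * (of_real (u j) * V j z + V (Suc j) z)"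
    unfolding u_V_plus_V[OF z] using V_single[OF z 1(1)] 1(2) by simp
  then show ?thesis
    using 1(1) by (simp add: jacobi_polynomial_def map_poly_pCons algebra_simps)
next
  case 2
  obtain m where m: "n (Suc j) = Suc m" using start_pos[of "Suc j"] gr0_conv_Suc by blast
  have V: "z * V (Suc j) z = R (Suc m) z" using V_double[OF z 2(1)] m by simp
  have c: "c m = l (Suc j)" and b: "b (Suc m) = e (Suc j)"
    using double(4)[OF 2(1)] double(1)[OF 2(1)] m by simp_all
  have "z * (z * V (Suc j) z) = R (Suc (Suc m)) z + of_real (e (Suc j)) * (z * V (Suc j) z)
      + of_real (l (Suc j)) * R m z"
    unfolding V using R_Suc_Suc[OF z, of m] by (simp only: c b)
  moreover have "of_real (u j) * V j z + V (Suc j) z = R m z"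
    "of_real (u (Suc j)) * V (Suc j) z + V (Suc (Suc j)) z = R (Suc (Suc m)) z"
    using u_V_plus_V[OF z, of j] u_V_plus_V[OF z, of "Suc j"] m 2(2) by simp_all
  ultimately have "z * (z * V (Suc j) z) =
      of_real (u (Suc j)) * V (Suc j) z + V (Suc (Suc j)) z + of_real (e (Suc j)) * (z * V (Suc j) z)
      + of_real (l (Suc j)) * (of_real (u j) * V j z + V (Suc j) z)" by simp
  then show ?thesis
    using 2(1) by (simp add: jacobi_polynomial_def map_poly_pCons algebra_simps)
qed

text \<open>The term \<open>g 0\<close> is the last entry of \<open>L P_hat\<close> in the first
  block: \<open>sm\<close> for size 1, and \<open>moment \<sigma> 0\<close> for size 2, where
  \<open>sm = 0\<close>.\<close>

lemma V_recurrence_0: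
  assumes z: "z \<in> upper_half_plane"
  shows "V 1 z = poly (map_poly of_real (p 0)) z * V 0 z + of_real (g 0)"
proof (cases rule: block_size_cases[of 0])
  case 1
  then show ?thesis
    using V_0[OF z] u_V_plus_V[OF z, of 0] g_0
    by (simp add: n_0 jacobi_polynomial_def map_poly_pCons algebra_simps)
next
  case 2
  have "z * (z * V 0 z) = R 1 z + of_real (b 0) * (z * V 0 z) - of_real (moment \<sigma> 0)"
    using V_double[OF z 2(1)] R_Suc_0[OF z] by (simp add: n_0)
  moreover have "of_real (u 0) * V 0 z + V 1 z = R 1 z"
    using u_V_plus_V[OF z, of 0] 2(2) by (simp add: n_0)
  ultimately show ?thesis
    using 2(1) double(1)[OF 2(1)] g_0
    by (simp add: n_0 jacobi_polynomial_def map_poly_pCons algebra_simps)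
qed

section \<open>Expansion and order of decay of \<open>V\<close>\<close>

lemma V_holomorphic: "V j holomorphic_on upper_half_plane"
proof (cases "j = 0")
  case True
  have "(\<lambda>z. (F z - of_real sm) / z) holomorphic_on upper_half_plane"
    using F_holomorphic upper_half_plane_nonzero by (intro holomorphic_intros) auto
  then show ?thesis by (rule holomorphic_transform) (simp add: V_def True)
next
  case False
  have "(\<lambda>z. (R (n j) z + of_real (if block_size n j = 1 then l j else 0) * R (n j - 1) z) / z)
      holomorphic_on upper_half_plane"
    using R_holomorphic upper_half_plane_nonzero by (intro holomorphic_intros) auto
  then show ?thesis
    by (rule holomorphic_transform) (simp add: V_def q_def False cauchy_add cauchy_smult)
qed

definition v :: "nat \<Rightarrow> real fps" where
  "v j = fps_X * (fps_const (if j = 0 then - sm else 0) * 1 +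
     Abs_fps (case_nat 0 (\<lambda>i. - S (monom 1 i * q j))))"

lemma v_nth: "v j $ 0 = 0" "v j $ Suc 0 = (if j = 0 then - sm else 0)"
  "v j $ Suc (Suc i) = - S (monom 1 i * q j)"
  by (simp_all add: v_def)

lemma sector_expansion_V: "sector_expansion (V j) (v j)"
proof -
  have "sector_expansion (\<lambda>z. (of_real (if j = 0 then - sm else 0) * 1 + cauchy (q j) z) / z) (v j)"
    unfolding v_def
    by (intro sector_expansion_divide_var sector_expansion_add sector_expansion_cmult
        sector_expansion_one sector_expansion_cauchy)
  then show ?thesis
    by (rule sector_expansion_cong) (auto simp: V_def F_eq q_def n_0 P_0)
qed

lemma S_monom_P: "i \<le> k \<Longrightarrow> S (monom 1 i * P k) = (if i = k then h k else 0)"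
  using S_mult_P_eq_0[of "monom 1 i" k] by (simp add: h_def degree_monom_eq)

text \<open>Orthogonality lets \<open>cauchy (P k)\<close> start with
  \<open>1 / z ^ (k + 1)\<close>, and division by \<open>z\<close> adds one more power. For
  \<open>j > 0\<close> in a block of size 1 the summand with \<open>P (n j - 1)\<close> dominates,
  which gives the order \<open>n (Suc j)\<close> for both sizes; a first block of size 1 starts with
  the term of \<open>- sm\<close>.\<close>

lemma v_vanish: "i < n (Suc j) \<Longrightarrow> v j $ i = 0"
  and v_leading: "v j $ n (Suc j) = - g j"
proof -
  have "(\<forall>i<n (Suc j). v j $ i = 0) \<and> v j $ n (Suc j) = - g j"
  proof (cases "j = 0")
    case True
    have v0: "v 0 $ 0 = 0" "v 0 $ Suc 0 = - sm" by (simp_all add: v_nth)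
    show ?thesis
    proof (cases rule: block_size_cases[of 0])
      case 1
      then show ?thesis using n_0 g_0 v0 by (simp add: True)
    next
      case 2
      have v1: "v 0 $ Suc 0 = 0" by (rule trans[OF v0(2)]) (simp add: sm_eq_0[OF 2(1)])
      have "v 0 $ Suc (Suc 0) = - moment \<sigma> 0"
        using 2 S_monom_P[of 0 0] by (simp add: v_nth q_def n_0 h_0)
      then show ?thesis using v0(1) v1 n_0 g_0 2 by (simp add: True less_Suc_eq numeral_2_eq_2)
    qed
  next
    case False
    then obtain m where m: "n j = Suc m" using start_pos[of j] gr0_conv_Suc by blast
    have nth: "v j $ i = (if i < 2 then 0 else - S (monom 1 (i - 2) * q j))" for i
      using False v_nth[of j] by (cases i; cases "i - 1") auto
    show ?thesis
    proof (cases rule: block_size_cases[of j])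
      case 1
      have "S (monom 1 i * q j) = l j * (if i = m then h m else 0)" if "i \<le> m" for i
        using that False m 1 by (simp add: q_def distrib_left S_linear S_monom_P)
      then show ?thesis using 1 m False by (auto simp: nth g_single)
    next
      case 2
      have "S (monom 1 i * q j) = (if i = n j then h (n j) else 0)" if "i \<le> n j" for i
        using that 2 by (simp add: q_def S_monom_P)
      then show ?thesis using 2 by (auto simp: nth g_double)
    qed
  qed
  then show "i < n (Suc j) \<Longrightarrow> v j $ i = 0" and "v j $ n (Suc j) = - g j" by auto
qed

lemma continued_fraction:
  obtains \<Phi> where "\<Phi> 0 = (\<lambda>z. (F z / z - of_real sm / z) / of_real \<bar>g 0\<bar>)"
    and "continued_fraction_expansion \<Phi> (\<lambda>j. sgn (g j)) p (\<lambda>j. sqrt \<bar>l (Suc j) * u j\<bar>)"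
proof
  \<comment> \<open>The constant -1, of order \<open>n 0 = 0\<close>, turns the inhomogeneous
    \<open>V_recurrence_0\<close> into the case \<open>j = 0\<close> of a common recurrence.
    Division by \<open>g i\<close> gives leading coefficient -1, and the index shift gives
    \<open>Y j\<close> the order \<open>n j\<close>.\<close>
  define Y where "Y j z = (case j of 0 \<Rightarrow> - 1 | Suc i \<Rightarrow> of_real (1 / g i) * V i z)" for j and z
  define y where "y j = (case j of 0 \<Rightarrow> fps_const (-1) * 1 | Suc i \<Rightarrow> fps_const (1 / g i) * v i)" for j
  let ?\<Phi> = "\<lambda>j z. - of_real (sgn (g j)) * (Y (Suc j) z / Y j z)"
  show "?\<Phi> 0 = (\<lambda>z. (F z / z - of_real sm / z) / of_real \<bar>g 0\<bar>)"
  proof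
    fix z
    have "sgn (g 0) / g 0 = 1 / \<bar>g 0\<bar>" using g_nonzero[of 0] by (simp add: sgn_real_def)
    then have "complex_of_real (sgn (g 0)) / of_real (g 0) = 1 / of_real \<bar>g 0\<bar>"
      by (metis of_real_1 of_real_divide)
    moreover have "?\<Phi> 0 z = of_real (sgn (g 0)) / of_real (g 0) * ((F z - of_real sm) / z)"
      by (simp add: Y_def V_def)
    ultimately show "?\<Phi> 0 z = (F z / z - of_real sm / z) / of_real \<bar>g 0\<bar>"
      by (simp add: diff_divide_distrib)
  qed
  show "continued_fraction_expansion ?\<Phi> (\<lambda>j. sgn (g j)) p (\<lambda>j. sqrt \<bar>l (Suc j) * u j\<bar>)"
  proof (rule continued_fraction_expansion_of_recurrence[where y = y and n = n])
    show "Y j holomorphic_on upper_half_plane" for j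
      unfolding Y_def using V_holomorphic by (cases j) (auto intro!: holomorphic_intros)
    show "sector_expansion (Y j) (y j)" for j
    proof (cases j)
      case 0
      show ?thesis
        using sector_expansion_cmult[OF sector_expansion_one, of "-1"] by (simp add: Y_def[abs_def] y_def 0)
    next
      case (Suc i)
      show ?thesis
        using sector_expansion_cmult[OF sector_expansion_V[of i], of "1 / g i"]
        by (simp add: Y_def[abs_def] y_def Suc)
    qed
    show "y j $ i = 0" if "i < n j" for i j
      using that v_vanish n_0 by (cases j) (auto simp: y_def)
    show "y j $ n j = - 1" for j
      using v_leading g_nonzero n_0 by (cases j) (auto simp: y_def)
    show "n j < n (Suc j)" for j by (rule less_Suc_block)
    show "l (Suc j) * u j \<noteq> 0" for j using l_nonzero u_nonzero by simp
    show "lead_coeff (p j) = 1" for j by (rule lead_coeff_jacobi_polynomial)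
    show "\<bar>sgn (g 0)\<bar> = 1" using g_nonzero[of 0] by (simp add: abs_sgn_eq)
    show "sgn (g (Suc j)) = sgn (g j) * sgn (l (Suc j) * u j)" for j
      by (simp add: g_Suc sgn_mult mult_ac)
    show "of_real (l (Suc j) * u j) * Y (Suc (Suc j)) z =
        poly (map_poly of_real (p j)) z * Y (Suc j) z - Y j z"
      if z: "z \<in> upper_half_plane" for j z
    proof -
      \<comment> \<open>The recurrence is checked after multiplication by \<open>g j\<close>, which
        by \<open>g_Suc\<close> turns the normalized functions back into \<open>V\<close>.\<close>
      have "of_real (g j) * of_real (l (Suc j) * u j) * Y (Suc (Suc j)) z = V (Suc j) z"
        using g_nonzero[of "Suc j"] unfolding Y_def nat.case
        by (simp add: g_Suc field_simps flip: of_real_mult)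
      moreover have "of_real (g j) * Y (Suc j) z = V j z"
        using g_nonzero[of j] by (simp add: Y_def)
      moreover have "V (Suc j) z = poly (map_poly of_real (p j)) z * V j z - of_real (g j) * Y j z"
      proof (cases j)
        case 0
        then show ?thesis using V_recurrence_0[OF z] by (simp add: Y_def)
      next
        case (Suc i)
        have "of_real (g j) * Y j z = of_real (l (Suc i) * u i) * V i z"
          using g_nonzero[of i] by (simp add: Y_def Suc g_Suc)
        then show ?thesis using V_recurrence_Suc[OF z, of i] by (simp add: Suc)
      qed
      ultimately have "of_real (g j) * (of_real (l (Suc j) * u j) * Y (Suc (Suc j)) z) =
          of_real (g j) * (poly (map_poly of_real (p j)) z * Y (Suc j) z - Y j z)"
        by (simp add: algebra_simps)
      then show ?thesis using g_nonzero[of j] by simp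
    qed
  qed
qed

abbreviation F_shifted :: "complex \<Rightarrow> complex" where
  "F_shifted \<equiv> \<lambda>z. F z / z - of_real sm / z"

lemma has_asymptotics_shifted: "has_asymptotics F_shifted (case_nat sm (moment \<sigma>))"
proof -
  have "S (monom 1 i * P 0) = moment \<sigma> i" for i
    unfolding sequence_functional_monom_mult P_0 by (simp add: sequence_functional_def)
  then have "- v 0 $ Suc j = case_nat sm (moment \<sigma>) j" for j
    by (cases j) (simp_all add: v_nth q_def n_0)
  moreover have "V 0 = F_shifted" by (auto simp: V_def diff_divide_distrib)
  ultimately show ?thesis
    using sector_expansion_imp_has_asymptotics[OF sector_expansion_V[of 0]] by (simp add: v_nth)
qed

lemma first_nonzero_shifted: "first_nonzero (case_nat sm (moment \<sigma>)) = g 0"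
proof (cases rule: block_size_cases[of 0])
  case 1
  then have "sm \<noteq> 0" using g_nonzero[of 0] g_0 by simp
  then show ?thesis using 1 g_0 unfolding first_nonzero_def by (subst Least_equality[of _ 0]) auto
next
  case 2
  have "(LEAST i. case_nat sm (moment \<sigma>) i \<noteq> 0) = 1"
    using sm_eq_0[OF 2(1)] mass_pos by (intro Least_equality) (auto split: nat.splits)
  then show ?thesis using 2 g_0 by (simp add: first_nonzero_def)
qed

lemma generalized_jacobi_matrix_of_shifted:
  assumes "F_shifted \<in> D_plus_minus_inf" "\<not> rational_function F_shifted"
  shows "generalized_jacobi_matrix_of F_shifted (lower_factor n e l \<star> upper_factor n u)"
proof -
  obtain \<Phi> where \<Phi>: "\<Phi> 0 = (\<lambda>z. F_shifted z / of_real \<bar>g 0\<bar>)"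
    "continued_fraction_expansion \<Phi> (\<lambda>j. sgn (g j)) p (\<lambda>j. sqrt \<bar>l (Suc j) * u j\<bar>)"
    by (rule continued_fraction)
  \<comment> \<open>Thus the coefficients
    \<open>\<epsilon> j * \<epsilon> (j + 1) * (\<beta> j)\<^sup>2\<close> of the generalized Jacobi
    matrix are the subdiagonal entries of \<open>L U\<close>.\<close>
  have "sgn (g j) * sgn (g (j + 1)) * (sqrt \<bar>l (Suc j) * u j\<bar>)\<^sup>2 = l (Suc j) * u j" for j
  proof -
    have "sgn (g j) * sgn (g j) = 1" using g_nonzero[of j] by (simp add: sgn_real_def)
    then have "sgn (g j) * sgn (g (j + 1)) = sgn (l (Suc j) * u j)"
      by (simp add: g_Suc sgn_mult mult_ac)
    then show ?thesis by (simp only: real_sqrt_pow2 abs_ge_zero sgn_mult_abs)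
  qed
  then have "lower_factor n e l \<star> upper_factor n u = generalized_jacobi_matrix n p
      (\<lambda>j. sgn (g j) * sgn (g (j + 1)) * (sqrt \<bar>l (Suc j) * u j\<bar>)\<^sup>2)"
    by (simp only: LU_eq_generalized_jacobi_matrix)
  then show ?thesis
    unfolding generalized_jacobi_matrix_of_def
    using assms has_asymptotics_shifted \<Phi> first_nonzero_shifted degree_jacobi_polynomial n_def
    by (intro conjI exI[of _ "case_nat sm (moment \<sigma>)"] exI[of _ \<Phi>] exI[of _ "\<lambda>j. sgn (g j)"]
        exI[of _ p] exI[of _ "\<lambda>j. sqrt \<bar>l (Suc j) * u j\<bar>"]) auto
qed

end

lemma has_asymptotics_cong:
  assumes "has_asymptotics F s" "\<And>z. z \<in> upper_half_plane \<Longrightarrow> F z = G z"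
  shows "has_asymptotics G s"
  unfolding has_asymptotics_def
proof (intro allI impI)
  fix n and \<epsilon> :: real assume e: "\<epsilon> > 0"
  have "eventually (\<lambda>z. F z - (- (\<Sum>j\<le>2 * n. of_real (s j) / z ^ (j + 1))) =
      G z - (- (\<Sum>j\<le>2 * n. of_real (s j) / z ^ (j + 1)))) (sector_infinity \<epsilon>)"
    using eventually_sector_upper_half_plane[OF e] by eventually_elim (simp add: assms(2))
  from landau_o.small.in_cong[OF this]
  show "(\<lambda>z. G z - (- (\<Sum>j\<le>2 * n. of_real (s j) / z ^ (j + 1)))) \<in> o[sector_infinity \<epsilon>](\<lambda>z. 1 / z ^ (2 * n + 1))"
    using assms(1) e unfolding has_asymptotics_def by blast
qed

lemma N_minus_inf_cong:
  assumes "F \<in> N_minus_inf" "\<And>z. z \<in> upper_half_plane \<Longrightarrow> F z = G z"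
  shows "G \<in> N_minus_inf"
proof -
  have "G holomorphic_on upper_half_plane"
    using assms(1) by (intro holomorphic_transform[OF _ assms(2)]) (auto simp: N_minus_inf_def nevanlinna_def)
  moreover have "G ` upper_half_plane \<subseteq> upper_half_plane"
    using assms unfolding N_minus_inf_def nevanlinna_def by fastforce
  ultimately show ?thesis
    using assms has_asymptotics_cong[of F _ G] unfolding N_minus_inf_def nevanlinna_def by blast
qed

lemma rational_function_shifted:
  assumes "rational_function (\<lambda>z. F z / z - of_real a / z)"
  shows "rational_function F"
proof -
  obtain r s where s: "s \<noteq> 0"
    "\<And>z. z \<in> upper_half_plane \<Longrightarrow> poly s z \<noteq> 0 \<Longrightarrow> F z / z - of_real a / z = poly r z / poly s z"
    using assms unfolding rational_function_def by blast
  have "F z = poly ([:0, 1:] * r + smult (of_real a) s) z / poly s z"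
    if "z \<in> upper_half_plane" "poly s z \<noteq> 0" for z
  proof -
    have "z \<noteq> 0" using that(1) by (auto simp: upper_half_plane_def)
    then show ?thesis using s(2)[OF that] that(2) by (simp add: field_simps)
  qed
  then show ?thesis unfolding rational_function_def using s(1) by blast
qed

theorem theorem4p5:
  fixes F :: "complex \<Rightarrow> complex" and \<sigma> :: "real measure" and P :: "nat \<Rightarrow> real poly"
    and sm :: real and J U L :: inf_matrix
  assumes "F \<in> N_minus_inf" and "\<not> rational_function F"
    and "representing_measure \<sigma> F"
    and "monic_jacobi_matrix_of \<sigma> P J"
    and "block_UL_factorization \<sigma> P sm J U L"
  shows "(\<lambda>z. F z / z - of_real sm / z) \<in> D_plus_minus_inf \<and>
         generalized_jacobi_matrix_of (\<lambda>z. F z / z - of_real sm / z) (L \<star> U)"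
proof -
  interpret moment_measure \<sigma>
    using assms(3) unfolding representing_measure_def by (intro moment_measure.intro) blast+
  obtain b c where bc: "monic_orthogonal \<sigma> P" "three_term_recurrence P b c" "\<And>j. c j > 0"
    "J = jacobi_matrix b c"
    using assms(4) unfolding monic_jacobi_matrix_of_def by blast
  have F_eq: "F z = cauchy 1 z" if "z \<in> upper_half_plane" for z
    using assms(3) that by (simp add: representing_measure_def cauchy_def)
  have F_range: "F z \<in> upper_half_plane" if "z \<in> upper_half_plane" for z
    using assms(1) that by (auto simp: N_minus_inf_def nevanlinna_def)
  \<comment> \<open>Mass 0 would give \<open>F \<i> = 0\<close>, but \<open>F\<close> maps into the
    open upper half plane.\<close>
  have "moment \<sigma> 0 > 0"
  proof (rule ccontr)
    assume "\<not> moment \<sigma> 0 > 0"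
    moreover have "moment \<sigma> 0 = measure \<sigma> (space \<sigma>)" by (simp add: moment_def)
    ultimately have "measure \<sigma> (space \<sigma>) = 0"
      using measure_nonneg[of \<sigma> "space \<sigma>"] by linarith
    then have "norm (F \<i>) \<le> 0"
      using norm_cauchy_le[of \<i> 1] F_eq[of \<i>] by (simp add: upper_half_plane_def)
    then show False using F_range[of \<i>] by (simp add: upper_half_plane_def)
  qed
  then interpret shifted_moments \<sigma> P b c sm
    using bc(1-3) by unfold_locales
  define l where "l = (\<lambda>j. - T (P (n (Suc j) - 1)) / T (P (n j - 1)))"
  have "\<exists>u e. U = upper_factor n u \<and> L = lower_factor n e l \<and> J = U \<star> L"
    using assms(5) unfolding block_UL_factorization_def Let_def P_hat_at_0 n_def l_def Suc_eq_plus1 .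
  then obtain u e where ue: "U = upper_factor n u" "L = lower_factor n e l" "J = U \<star> L"
    by (elim exE conjE)
  interpret block_UL \<sigma> P b c sm F u e l
  proof unfold_locales
    show "F holomorphic_on upper_half_plane"
      using assms(1) by (simp add: N_minus_inf_def nevanlinna_def)
    show "F z = cauchy 1 z" if "z \<in> upper_half_plane" for z
      using that by (rule F_eq)
    show "jacobi_matrix b c = upper_factor n u \<star> lower_factor n e l"
      using bc(4) ue by simp
    show "l j = - T (P (n (Suc j) - 1)) / T (P (n j - 1))" for j
      by (simp only: l_def)
  qed
  have "F_shifted holomorphic_on upper_half_plane"
    using F_holomorphic upper_half_plane_nonzero by (intro holomorphic_intros) auto
  then have "F_shifted meromorphic_on upper_half_plane"
    by (intro analytic_on_imp_meromorphic_on) (simp add: analytic_on_open open_upper_half_plane)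
  \<comment> \<open>On the half plane this function is \<open>F\<close> itself.\<close>
  moreover have "(\<lambda>z. z * F_shifted z + of_real sm) \<in> N_minus_inf"
    using assms(1) by (rule N_minus_inf_cong) (auto dest!: upper_half_plane_nonzero simp: field_simps)
  ultimately have "F_shifted \<in> D_plus_minus_inf"
    using has_asymptotics_shifted unfolding D_plus_minus_inf_def mem_Collect_eq
    by (intro conjI exI[of _ "case_nat sm (moment \<sigma>)"]) simp_all
  moreover have "\<not> rational_function F_shifted"
    using assms(2) rational_function_shifted by blast
  ultimately show ?thesis
    using generalized_jacobi_matrix_of_shifted unfolding ue(1,2) by blast
qed

end
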